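(* For every integer $t$ there is a constant $C=C(t)$ such that for every $n$, $\mathrm{ex}_{\hom}\bigl(n,K_t^{(3)}\bigr)\le C n^{8/3}$. That is, every $3$-uniform hypergraph on $n$ vertices with more than $Cn^{8/3}$ edges contains a subhypergraph whose associated simplicial complex is homeomorphic to (the simplicial complex of) $K_t^{(3)}$.
   Context: A $3$-uniform hypergraph $H$ is identified with the $2$-dimensional simplicial complex whose facets are the edges of $H$ (together with all their faces). $K_t^{(3)}$ denotes the complete $3$-uniform hypergraph on $t$ vertices, viewed as a $2$-dimensional simplicial complex (the $2$-skeleton of the $(t-1)$-simplex). A homeomorph of a $2$-dimensional simplicial complex $X$ in $H$ is a subhypergraph of $H$ whose associated simplicial complex is homeomorphic to $X$. The topological Turán number $\mathrm{ex}_{\hom}(n,X)$ is the maximum number of edges in a $3$-uniform hypergraph on $n$ vertices containing no homeomorph of $X$. *)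

theory Defs
  imports "HOL-Analysis.Analysis"
begin

definition uniform3_on :: "nat set \<Rightarrow> nat set set \<Rightarrow> bool" where
  "uniform3_on V H \<longleftrightarrow> finite V \<and> (\<forall>e\<in>H. e \<subseteq> V \<and> card e = 3)"

definition simplex_realization :: "nat set \<Rightarrow> (nat \<Rightarrow> real) set" where
  "simplex_realization \<sigma> =
     {f. (\<forall>v. 0 \<le> f v) \<and> (\<forall>v. v \<notin> \<sigma> \<longrightarrow> f v = 0) \<and> sum f \<sigma> = 1}"

text \<open>Geometric realization of the simplicial complex whose facets are the edges of H
  (together with all their faces): union of the closed simplices of the edges.\<close>
definition realization :: "nat set set \<Rightarrow> (nat \<Rightarrow> real) set" where
  "realization H = (\<Union>e\<in>H. simplex_realization e)"

text \<open>Topological space of the realization (subspace of R^nat with the product topology;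
  for finite complexes this is the standard topology).\<close>
definition realization_space :: "nat set set \<Rightarrow> (nat \<Rightarrow> real) topology" where
  "realization_space H = subtopology (powertop_real UNIV) (realization H)"

definition complete3 :: "nat \<Rightarrow> nat set set" where
  "complete3 t = {e. e \<subseteq> {0..<t} \<and> card e = 3}"

definition contains_homeomorph :: "nat set set \<Rightarrow> nat set set \<Rightarrow> bool" where
  "contains_homeomorph H X \<longleftrightarrow>
     (\<exists>H'. H' \<subseteq> H \<and> realization_space H' homeomorphic_space realization_space X)"

end

theory Submission
  imports Defs "HOL-Real_Asymp.Real_Asymp"
begin

text \<open>For vertices \<open>a, b\<close> let \<open>L\<^sub>a\<^sub>b\<close> be the common link graph of \<open>a\<close> and \<open>b\<close>.  If \<open>T\<close> is a spider in
  \<open>L\<^sub>a\<^sub>b\<close>, then joining every edge of \<open>T\<close> with \<open>a\<close> and with \<open>b\<close> gives discs glued along the path from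
  \<open>a\<close> to \<open>b\<close> through the centre of \<open>T\<close>.  Hence a homeomorph of the complete complex arises from
  vertices \<open>v\<^sub>i\<close>, one further vertex \<open>x\<^sub>i\<^sub>j\<^sub>k\<close> for every triple, and, for every pair \<open>ij\<close>, a spider in
  the link graph of \<open>v\<^sub>i\<close> and \<open>v\<^sub>j\<close> with feet \<open>x\<^sub>i\<^sub>j\<^sub>k\<close>, where distinct spiders meet only in feet.

  Such spiders can be found greedily if, for fixed \<open>i, j\<close>, the feet lie in one well connected piece
  of the link graph.  To ensure this, every \<open>L\<^sub>a\<^sub>b\<close> is replaced by a disjoint union of expanders of
  polylogarithmic minimum degree, at the cost of a small fraction of its edges and few further
  ones; all feet are neighbours of one vertex \<open>y\<close> in these subgraphs.  The vertices \<open>v\<^sub>i\<close> are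
  selected by dependent random choice: for a random ordered pair \<open>(x, y)\<close>, among the vertices \<open>z\<close>
  that form an edge with \<open>x\<close> and \<open>y\<close> almost all pairs \<open>a, b\<close> have \<open>xy\<close> in the subgraph of
  \<open>L\<^sub>a\<^sub>b\<close>, and almost all triples have many candidates \<open>x'\<close> that can replace \<open>x\<close>.  Prescribing three
  adjacencies for a foot is what costs a factor \<open>n powr (1 / 3)\<close>.\<close>

section \<open>A subdivision of the complete complex\<close>

lemma compact_simplex_realization:
  assumes "finite \<sigma>"
  shows "compact (simplex_realization \<sigma>)"
proof -
  have "simplex_realization \<sigma> \<subseteq> (\<Pi>\<^sub>E v\<in>UNIV. {0..1})"
  proof
    fix f assume f: "f \<in> simplex_realization \<sigma>"
    have "f v \<le> 1" for v
    proof (cases "v \<in> \<sigma>")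
      case True
      then show ?thesis
        using f member_le_sum[OF True, of f] assms by (auto simp: simplex_realization_def)
    qed (use f in \<open>auto simp: simplex_realization_def\<close>)
    then show "f \<in> (\<Pi>\<^sub>E v\<in>UNIV. {0..1})"
      using f by (auto simp: simplex_realization_def)
  qed
  moreover have "compact (\<Pi>\<^sub>E v\<in>(UNIV::nat set). {0..1::real})"
    using compactin_PiE[of "\<lambda>_::nat. euclideanreal" UNIV "\<lambda>_. {0..1}"]
    by (simp add: euclidean_product_topology)
  moreover have "closed (simplex_realization \<sigma>)"
  proof -
    have "simplex_realization \<sigma> =
        (\<Inter>v. {f. 0 \<le> f v}) \<inter> (\<Inter>v\<in>-\<sigma>. {f. f v = 0}) \<inter> {f. (\<Sum>v\<in>\<sigma>. f v) = 1}"
      by (auto simp: simplex_realization_def)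
    moreover have "closed \<dots>"
      by (intro closed_Int closed_INT ballI closed_Collect_le closed_Collect_eq
          continuous_on_sum continuous_on_const continuous_on_product_coordinates)
    ultimately show ?thesis by simp
  qed
  ultimately show ?thesis
    using compact_Int_closed[of "\<Pi>\<^sub>E v\<in>(UNIV::nat set). {0..1::real}" "simplex_realization \<sigma>"]
    by (simp add: Int_absorb1)
qed

text \<open>A continuous bijection from a compact space onto a Hausdorff space has a continuous
  inverse, so no inverse of \<open>\<Phi>\<close> has to be constructed.\<close>

lemma homeomorphic_realization_spaceI:
  assumes fin: "finite H" "\<And>e. e \<in> H \<Longrightarrow> finite e"
    and cont: "continuous_on (realization H) \<Phi>"
    and img: "\<Phi> ` realization H = realization X"
    and inj: "inj_on \<Phi> (realization H)"
  shows "realization_space H homeomorphic_space realization_space X"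
proof -
  have "compact (realization H)"
    unfolding realization_def using fin by (intro compact_UN compact_simplex_realization) auto
  then have "realization H homeomorphic realization X"
    using homeomorphic_compact[OF _ cont img inj] by simp
  then show ?thesis
    unfolding realization_space_def euclidean_product_topology homeomorphic_space_def
      homeomorphic_maps_def homeomorphic_def homeomorphism_def
    by (fastforce simp: continuous_map_in_subtopology)
qed

text \<open>The triple stands for the chain vertex \<open>i\<close>, edge \<open>ij\<close>,
  triangle \<open>ijk\<close>, hence for one triangle of the barycentric subdivision of the complete
  complex.\<close>

definition flag :: "nat \<Rightarrow> nat \<Rightarrow> nat \<Rightarrow> nat \<Rightarrow> bool" where
  "flag t i j k \<longleftrightarrow> i < t \<and> j < t \<and> k < t \<and> i \<noteq> j \<and> i \<noteq> k \<and> j \<noteq> k"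

text \<open>For each pair \<^term>\<open>{i, j}\<close> the legs \<^term>\<open>P {i, j} k\<close>, for \<open>k\<close> outside the pair, form a
  spider whose centre plays the role of the midpoint of the edge \<open>ij\<close> of the complete complex, and
  whose feet play the role of the barycentres of the triangles \<open>ijk\<close>.  A foot is shared by the
  three spiders of its triangle.\<close>

locale spiders =
  fixes t :: nat and v :: "nat \<Rightarrow> nat" and P :: "nat set \<Rightarrow> nat \<Rightarrow> nat \<Rightarrow> nat"
    and len :: "nat set \<Rightarrow> nat \<Rightarrow> nat"
  assumes inj_v: "inj_on v {..<t}"
    and len_pos: "flag t i j k \<Longrightarrow> 0 < len {i, j} k"
    and v_neq_P: "\<lbrakk>flag t i j k; s \<le> len {i, j} k; l < t\<rbrakk> \<Longrightarrow> v l \<noteq> P {i, j} k s"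
    and P_start: "\<lbrakk>flag t i j k; flag t i j k'\<rbrakk> \<Longrightarrow> P {i, j} k 0 = P {i, j} k' 0"
    and P_end: "\<lbrakk>flag t i j k; flag t i' j' k'; {i, j, k} = {i', j', k'}\<rbrakk>
        \<Longrightarrow> P {i, j} k (len {i, j} k) = P {i', j'} k' (len {i', j'} k')"
    and P_eqD: "\<lbrakk>flag t i j k; flag t i' j' k'; s \<le> len {i, j} k; s' \<le> len {i', j'} k';
        P {i, j} k s = P {i', j'} k' s'\<rbrakk> \<Longrightarrow>
        {i, j} = {i', j'} \<and> k = k' \<and> s = s' \<or> {i, j} = {i', j'} \<and> s = 0 \<and> s' = 0 \<or>
        s = len {i, j} k \<and> s' = len {i', j'} k' \<and> {i, j, k} = {i', j', k'}"
begin

text \<open>Opposite to its corner \<open>i\<close>, the barycentric triangle of a flag has the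
  segment from the midpoint of \<open>ij\<close> to the barycentre of \<open>ijk\<close>. This
  segment is subdivided like the leg and coned off from \<open>v i\<close>.\<close>

definition fans :: "nat set set" where
  "fans = {{v i, P {i, j} k s, P {i, j} k (Suc s)} | i j k s. flag t i j k \<and> s < len {i, j} k}"

text \<open>The point at fraction \<open>s / len e k\<close> of the way from the midpoint of
  \<open>e\<close> to the barycentre of \<open>insert k e\<close>.\<close>

definition leg_point :: "nat set \<Rightarrow> nat \<Rightarrow> nat \<Rightarrow> nat \<Rightarrow> real" where
  "leg_point e k s l = (1 - s / len e k) / 2 * of_bool (l \<in> e)
     + s / len e k / 3 * of_bool (l \<in> insert k e)"

text \<open>A vertex can occur in several fans, so its image is chosen among all its descriptions;
  \<open>v_neq_P\<close> and \<open>leg_point_cong\<close> make them agree.\<close>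

definition target :: "nat \<Rightarrow> nat \<Rightarrow> real" where
  "target u = (SOME c. (\<exists>i<t. u = v i \<and> c = (\<lambda>l. of_bool (l = i))) \<or>
     (\<exists>i j k s. flag t i j k \<and> s \<le> len {i, j} k \<and> u = P {i, j} k s \<and> c = leg_point {i, j} k s))"

text \<open>The extension of \<open>target\<close> that is affine on every simplex. Summing over all
  vertices gives one formula for all simplices, which makes continuity immediate.\<close>

definition \<Phi> :: "(nat \<Rightarrow> real) \<Rightarrow> nat \<Rightarrow> real" where
  "\<Phi> f l = (\<Sum>u\<in>\<Union>fans. f u * target u l)"

lemma target_v:
  assumes "i < t"
  shows "target (v i) = (\<lambda>l. of_bool (l = i))"
  unfolding target_def
proof (rule some_equality)
  fix c
  assume "(\<exists>i'<t. v i = v i' \<and> c = (\<lambda>l. of_bool (l = i'))) \<or>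
     (\<exists>i' j k s. flag t i' j k \<and> s \<le> len {i', j} k \<and> v i = P {i', j} k s \<and> c = leg_point {i', j} k s)"
  then consider i' where "i' < t" "v i = v i'" "c = (\<lambda>l. of_bool (l = i'))"
    | i' j k s where "flag t i' j k" "s \<le> len {i', j} k" "v i = P {i', j} k s"
    by blast
  then show "c = (\<lambda>l. of_bool (l = i))"
  proof cases
    case 1
    then have "i = i'" using inj_onD[OF inj_v, of i i'] assms by simp
    then show ?thesis using 1 by simp
  next
    case 2
    then show ?thesis using v_neq_P[OF 2(1,2) assms] by simp
  qed
qed (use assms in auto)

text \<open>The coincidences that \<open>P_eqD\<close> admits are harmless: at the centre the point
  depends on the pair only, and at the foot on the triple only.\<close>

lemma leg_point_cong:
  assumes fl: "flag t i j k" "flag t i' j' k'" and s: "s \<le> len {i, j} k" "s' \<le> len {i', j'} k'"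
    and eq: "P {i, j} k s = P {i', j'} k' s'"
  shows "leg_point {i, j} k s = leg_point {i', j'} k' s'"
  using P_eqD[OF fl s eq]
proof (elim disjE conjE)
  assume a: "s = len {i, j} k" "s' = len {i', j'} k'" "{i, j, k} = {i', j', k'}"
  have "insert k {i, j} = {i, j, k}" "insert k' {i', j'} = {i', j', k'}"
    by auto
  then have *: "insert k {i, j} = insert k' {i', j'}"
    using a(3) by simp
  have "0 < len {i, j} k" "0 < len {i', j'} k'"
    using len_pos fl by auto
  then show ?thesis
    unfolding leg_point_def fun_eq_iff * using a(1,2) by simp
next
  assume "{i, j} = {i', j'}" "s = 0" "s' = 0"
  then show ?thesis by (simp add: leg_point_def fun_eq_iff del: insert_iff)
qed simp

lemma target_P:
  assumes "flag t i j k" "s \<le> len {i, j} k"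
  shows "target (P {i, j} k s) = leg_point {i, j} k s"
  unfolding target_def
proof (rule some_equality)
  fix c
  assume "(\<exists>i'<t. P {i, j} k s = v i' \<and> c = (\<lambda>l. of_bool (l = i'))) \<or>
     (\<exists>i' j' k' s'. flag t i' j' k' \<and> s' \<le> len {i', j'} k' \<and> P {i, j} k s = P {i', j'} k' s'
        \<and> c = leg_point {i', j'} k' s')"
  then consider i' where "i' < t" "P {i, j} k s = v i'"
    | i' j' k' s' where "flag t i' j' k'" "s' \<le> len {i', j'} k'" "P {i, j} k s = P {i', j'} k' s'"
      "c = leg_point {i', j'} k' s'"
    by blast
  then show "c = leg_point {i, j} k s"
  proof cases
    case 1
    then show ?thesis using v_neq_P[OF assms 1(1)] by simp
  next
    case 2
    then show ?thesis using leg_point_cong[OF assms(1) 2(1) assms(2) 2(2,3)] by simp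
  qed
qed (use assms in blast)

lemma P_step_neq:
  assumes "flag t i j k" "s < len {i, j} k"
  shows "P {i, j} k s \<noteq> P {i, j} k (Suc s)"
  using P_eqD[of i j k i j k s "Suc s"] assms by auto

lemma finite_fans: "finite fans" and finite_fan: "e \<in> fans \<Longrightarrow> finite e"
proof -
  have "fans \<subseteq> (\<Union>i\<in>{..<t}. \<Union>j\<in>{..<t}. \<Union>k\<in>{..<t}. \<Union>s\<in>{..<len {i, j} k}.
      {{v i, P {i, j} k s, P {i, j} k (Suc s)}})"
    unfolding fans_def flag_def by auto
  then show "finite fans"
    by (rule finite_subset) auto
qed (auto simp: fans_def)

text \<open>\<^term>\<open>leg_mass L M \<gamma>\<close> is the weight that a distribution on the positions \<open>0, \<dots>, L\<close> of a
  leg, concentrated on two consecutive positions, with total weight \<open>M\<close> and first moment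
  \<open>L * \<gamma>\<close>, gives to a position.  It expresses a point of a fan in terms of its image only, which
  yields injectivity.\<close>

definition leg_mass :: "nat \<Rightarrow> real \<Rightarrow> real \<Rightarrow> nat \<Rightarrow> real" where
  "leg_mass L M \<gamma> s = max 0 (M - \<bar>L * \<gamma> - s * M\<bar>)"

text \<open>The candidate for the preimage of \<open>coords\<close> with the same parameters:
  \<open>\<alpha>\<close> is the weight of the apex, \<open>M\<close> that of the leg, and
  \<open>\<gamma> / M\<close> the relative mean position on the leg.\<close>

definition fan_point :: "nat \<Rightarrow> nat \<Rightarrow> nat \<Rightarrow> real \<Rightarrow> real \<Rightarrow> real \<Rightarrow> nat \<Rightarrow> real" where
  "fan_point i j k \<alpha> M \<gamma> u = \<alpha> * of_bool (u = v i)
     + (\<Sum>s\<le>len {i, j} k. leg_mass (len {i, j} k) M \<gamma> s * of_bool (u = P {i, j} k s))"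

text \<open>The point of the barycentric triangle with weight \<open>\<alpha>\<close> at the vertex
  \<open>i\<close>, \<open>M - \<gamma>\<close> at the midpoint of \<open>ij\<close>, and
  \<open>\<gamma>\<close> at the barycentre.\<close>

definition coords :: "nat \<Rightarrow> nat \<Rightarrow> nat \<Rightarrow> real \<Rightarrow> real \<Rightarrow> real \<Rightarrow> nat \<Rightarrow> real" where
  "coords i j k \<alpha> M \<gamma> l = \<alpha> * of_bool (l = i) + (M - \<gamma>) / 2 * of_bool (l \<in> {i, j})
     + \<gamma> / 3 * of_bool (l \<in> {i, j, k})"

lemma \<Phi>_fan:
  assumes fl: "flag t i j k" and s: "s < len {i, j} k"
    and f: "f \<in> simplex_realization {v i, P {i, j} k s, P {i, j} k (Suc s)}"
  defines "a \<equiv> f (P {i, j} k s)" and "b \<equiv> f (P {i, j} k (Suc s))"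
  shows "\<Phi> f = coords i j k (f (v i)) (a + b) ((a * s + b * Suc s) / len {i, j} k)"
proof
  fix l
  let ?L = "len {i, j} k" and ?e = "{v i, P {i, j} k s, P {i, j} k (Suc s)}"
  have it: "i < t" using fl by (auto simp: flag_def)
  have sub: "?e \<subseteq> \<Union>fans" using fl s unfolding fans_def by blast
  have ds: "v i \<noteq> P {i, j} k s" "v i \<noteq> P {i, j} k (Suc s)" "P {i, j} k s \<noteq> P {i, j} k (Suc s)"
    using v_neq_P[OF fl _ it] P_step_neq[OF fl s] s by auto
  have "\<Phi> f l = (\<Sum>u\<in>?e. f u * target u l)"
    unfolding \<Phi>_def using f finite_fans finite_fan
    by (intro sum.mono_neutral_right sub) (auto simp: simplex_realization_def)
  also have "\<dots> = f (v i) * of_bool (l = i) + a * leg_point {i, j} k s l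
      + b * leg_point {i, j} k (Suc s) l"
    using ds target_v[OF it] target_P[OF fl, of s] target_P[OF fl, of "Suc s"] s
    by (simp add: a_def b_def)
  also have "\<dots> = coords i j k (f (v i)) (a + b) ((a * s + b * Suc s) / len {i, j} k) l"
    using len_pos[OF fl] unfolding leg_point_def coords_def insert_commute[of k]
    by (auto simp: field_simps of_bool_def)
  finally show "\<Phi> f l = coords i j k (f (v i)) (a + b) ((a * s + b * Suc s) / len {i, j} k) l" .
qed

text \<open>Inside the absolute value stands \<open>b - (r - s) * (a + b)\<close>. This is
  \<open>b\<close> for \<open>r = s\<close>, \<open>- a\<close> for \<open>r = Suc s\<close>, and at
  least \<open>a + b\<close> in absolute value elsewhere, where the maximum gives 0.\<close>

lemma leg_mass_two_point:
  assumes "0 \<le> a" "0 \<le> b" "0 < L"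
  shows "leg_mass L (a + b) ((a * real s + b * real (Suc s)) / L) r
     = a * of_bool (r = s) + b * of_bool (r = Suc s)"
proof -
  have *: "L * ((a * s + b * Suc s) / L) - r * (a + b) = b - (real r - s) * (a + b)"
    using assms(3) by (simp add: field_simps)
  consider "r = s" | "r = Suc s" | "r < s" | "r > Suc s" by linarith
  then show ?thesis
  proof cases
    case 3
    then have "(real s - r) * (a + b) \<ge> 1 * (a + b)"
      using assms by (intro mult_right_mono) auto
    then have "b - (real r - s) * (a + b) \<ge> a + b" using assms by (simp add: algebra_simps)
    then show ?thesis unfolding leg_mass_def * using 3 assms by auto
  next
    case 4
    then have "(real r - s) * (a + b) \<ge> 2 * (a + b)"
      using assms by (intro mult_right_mono) auto
    then show ?thesis unfolding leg_mass_def * using 4 assms by auto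
  next
    case 1
    have "b - (real r - s) * (a + b) = b" using 1 by simp
    then show ?thesis unfolding leg_mass_def * using 1 assms by simp
  next
    case 2
    have "b - (real r - s) * (a + b) = - a" using 2 by simp
    then show ?thesis unfolding leg_mass_def * using 2 assms by simp
  qed
qed

lemma fan_point_fan:
  assumes fl: "flag t i j k" and s: "s < len {i, j} k"
    and f: "f \<in> simplex_realization {v i, P {i, j} k s, P {i, j} k (Suc s)}"
  defines "a \<equiv> f (P {i, j} k s)" and "b \<equiv> f (P {i, j} k (Suc s))"
  shows "f = fan_point i j k (f (v i)) (a + b) ((a * s + b * Suc s) / len {i, j} k)"
proof
  fix u
  have it: "i < t" using fl by (auto simp: flag_def)
  have ab: "0 \<le> a" "0 \<le> b" using f by (auto simp: a_def b_def simplex_realization_def)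
  have ds: "v i \<noteq> P {i, j} k s" "v i \<noteq> P {i, j} k (Suc s)" "P {i, j} k s \<noteq> P {i, j} k (Suc s)"
    using v_neq_P[OF fl _ it] P_step_neq[OF fl s] s by auto
  have *: "leg_mass (len {i, j} k) (a + b) ((a * s + b * Suc s) / len {i, j} k) r
     * of_bool (u = P {i, j} k r) = (if r = s then a * of_bool (u = P {i, j} k s) else 0)
      + (if r = Suc s then b * of_bool (u = P {i, j} k (Suc s)) else 0)" for r
    unfolding leg_mass_two_point[OF ab len_pos[OF fl]] by auto
  have "fan_point i j k (f (v i)) (a + b) ((a * s + b * Suc s) / len {i, j} k) u
      = f (v i) * of_bool (u = v i) + (a * of_bool (u = P {i, j} k s)
      + b * of_bool (u = P {i, j} k (Suc s)))"
    unfolding fan_point_def * sum.distrib using s by (subst (1 2) sum.delta) auto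
  also have "\<dots> = f u"
    using ds f by (auto simp: a_def b_def simplex_realization_def)
  finally show "f u = fan_point i j k (f (v i)) (a + b) ((a * s + b * Suc s) / len {i, j} k) u"
    by simp
qed

text \<open>A point and its image receive the same parameters. Injectivity and the image of
  \<open>\<Phi>\<close> thus become statements about \<open>coords\<close> and
  \<open>fan_point\<close>.\<close>

lemma realization_fansE:
  assumes "f \<in> realization fans"
  obtains i j k \<alpha> M \<gamma> where "flag t i j k" "0 \<le> \<alpha>" "0 \<le> \<gamma>" "\<gamma> \<le> M" "\<alpha> + M = 1"
    "f = fan_point i j k \<alpha> M \<gamma>" "\<Phi> f = coords i j k \<alpha> M \<gamma>"
proof -
  obtain i j k s where fl: "flag t i j k" and s: "s < len {i, j} k"
    and f: "f \<in> simplex_realization {v i, P {i, j} k s, P {i, j} k (Suc s)}"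
    using assms unfolding realization_def fans_def by blast
  define a where "a = f (P {i, j} k s)"
  define b where "b = f (P {i, j} k (Suc s))"
  have it: "i < t" using fl by (auto simp: flag_def)
  have ab: "0 \<le> a" "0 \<le> b" "0 \<le> f (v i)"
    using f by (auto simp: a_def b_def simplex_realization_def)
  have ds: "v i \<noteq> P {i, j} k s" "v i \<noteq> P {i, j} k (Suc s)" "P {i, j} k s \<noteq> P {i, j} k (Suc s)"
    using v_neq_P[OF fl _ it] P_step_neq[OF fl s] s by auto
  have "a * s + b * Suc s \<le> a * len {i, j} k + b * len {i, j} k"
    using s ab by (intro add_mono mult_left_mono) auto
  then have "(a * s + b * Suc s) / len {i, j} k \<le> a + b"
    using len_pos[OF fl] by (simp add: field_simps)
  moreover have "f (v i) + (a + b) = 1"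
    using f ds by (simp add: simplex_realization_def a_def b_def)
  ultimately show thesis
    using that[OF fl ab(3), of "(a * s + b * Suc s) / len {i, j} k" "a + b"] ab
      fan_point_fan[OF fl s f] \<Phi>_fan[OF fl s f] by (simp add: a_def b_def)
qed

text \<open>The mean position \<open>\<gamma> * len / M\<close> lies between two consecutive
  positions of the leg; splitting \<open>M\<close> between them with this mean gives a
  preimage.\<close>

lemma coords_in_image:
  assumes fl: "flag t i j k" and nn: "0 \<le> \<alpha>" "0 \<le> \<gamma>" "\<gamma> \<le> M" "\<alpha> + M = 1"
  shows "coords i j k \<alpha> M \<gamma> \<in> \<Phi> ` realization fans"
proof -
  let ?L = "len {i, j} k"
  have L: "0 < ?L" by (rule len_pos[OF fl])
  obtain s a b where s: "s < ?L" and ab: "0 \<le> a" "0 \<le> b" "a + b = M"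
    and mean: "a * s + b * Suc s = \<gamma> * ?L"
  proof (cases "M = 0 \<or> \<gamma> = M")
    \<comment> \<open>For \<open>M = 0\<close> there is no mean position, and for
      \<open>\<gamma> = M\<close> it is the foot, which has no successor on the leg. So the last
      step is used, with all weight at its end.\<close>
    case True
    then show ?thesis
      using that[of "?L - 1" 0 M] nn L by (auto simp: of_nat_diff)
  next
    case False
    define x where "x = \<gamma> * ?L / M"
    have M: "0 < M" "\<gamma> < M" using nn False by auto
    have x: "0 \<le> x" "x < ?L" using M nn L by (auto simp: x_def field_simps)
    define s where "s = nat \<lfloor>x\<rfloor>"
    have s: "real s \<le> x" "x < real s + 1" using x(1) by (auto simp: s_def)
    have "s < ?L" using s x by linarith
    moreover have "0 \<le> M * (s + 1 - x)" "0 \<le> M * (x - s)" using M s by auto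
    moreover have "M * (s + 1 - x) * s + M * (x - s) * Suc s = M * x"
      by (simp add: algebra_simps)
    moreover have "M * x = \<gamma> * ?L" using M by (simp add: x_def)
    ultimately show ?thesis
      using that[of s "M * (s + 1 - x)" "M * (x - s)"] by (simp add: algebra_simps)
  qed
  have it: "i < t" using fl by (auto simp: flag_def)
  have ds: "v i \<noteq> P {i, j} k s" "v i \<noteq> P {i, j} k (Suc s)" "P {i, j} k s \<noteq> P {i, j} k (Suc s)"
    using v_neq_P[OF fl _ it] P_step_neq[OF fl s] s by auto
  define f where "f = (\<lambda>_. 0)(v i := \<alpha>, P {i, j} k s := a, P {i, j} k (Suc s) := b)"
  have f: "f \<in> simplex_realization {v i, P {i, j} k s, P {i, j} k (Suc s)}"
    using ds ab nn by (auto simp: simplex_realization_def f_def)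
  have "\<Phi> f = coords i j k \<alpha> M \<gamma>"
    using \<Phi>_fan[OF fl s f] ds mean L ab by (simp add: f_def)
  moreover have "f \<in> realization fans"
    using f fl s unfolding realization_def fans_def by blast
  ultimately show ?thesis by (metis imageI)
qed

text \<open>Without weight at the apex the point lies on the leg, the side shared by the fans of
  \<open>v i\<close> and \<open>v j\<close>.\<close>

lemma fan_point_swap: "fan_point i j k 0 M \<gamma> = fan_point j i k 0 M \<gamma>"
  unfolding fan_point_def by (simp add: insert_commute)

text \<open>The side from the apex to the centre of the spider, shared by the flags with the same
  \<open>i\<close> and \<open>j\<close>.\<close>

lemma fan_point_center:
  assumes "flag t i j k" "0 \<le> M"
  shows "fan_point i j k \<alpha> M 0 u = \<alpha> * of_bool (u = v i) + M * of_bool (u = P {i, j} k 0)"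
proof -
  have "leg_mass (len {i, j} k) M 0 s * of_bool (u = P {i, j} k s)
      = (if s = 0 then M * of_bool (u = P {i, j} k 0) else 0)" for s
  proof (cases s)
    case (Suc r)
    have "M * 1 \<le> M * real s" using assms Suc by (intro mult_left_mono) auto
    then show ?thesis using assms Suc by (auto simp: leg_mass_def abs_mult mult.commute)
  qed (use assms in \<open>auto simp: leg_mass_def\<close>)
  then show ?thesis unfolding fan_point_def by (simp add: sum.delta)
qed

text \<open>The side from the apex to the foot, shared with the flag in which \<open>j\<close> and
  \<open>k\<close> are interchanged.\<close>

lemma fan_point_foot:
  assumes "flag t i j k" "0 \<le> M"
  shows "fan_point i j k \<alpha> M M u = \<alpha> * of_bool (u = v i)
    + M * of_bool (u = P {i, j} k (len {i, j} k))"
proof -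
  let ?L = "len {i, j} k"
  have "leg_mass ?L M M s * of_bool (u = P {i, j} k s)
      = (if s = ?L then M * of_bool (u = P {i, j} k ?L) else 0)" if "s \<le> ?L" for s
  proof (cases "s = ?L")
    case False
    then have "M * 1 \<le> M * (real ?L - real s)" using assms that by (intro mult_left_mono) auto
    then show ?thesis using False by (simp add: leg_mass_def algebra_simps)
  qed (use assms in \<open>auto simp: leg_mass_def\<close>)
  then show ?thesis unfolding fan_point_def by (simp add: sum.delta)
qed

text \<open>The coordinates in decreasing order determine the parameters, so two descriptions of a
  point differ only in how ties are broken. A tie puts the point on a side shared by fans, where the
  preceding lemmas apply.\<close>

lemma fan_point_eq_of_coords:
  assumes fl: "flag t i j k" "flag t i' j' k'"
    and nn: "0 \<le> \<alpha>" "0 \<le> \<gamma>" "\<gamma> \<le> M" "\<alpha> + M = 1" "0 \<le> \<alpha>'" "0 \<le> \<gamma>'" "\<gamma>' \<le> M'" "\<alpha>' + M' = 1"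
    and eq: "coords i j k \<alpha> M \<gamma> = coords i' j' k' \<alpha>' M' \<gamma>'"
  shows "fan_point i j k \<alpha> M \<gamma> = fan_point i' j' k' \<alpha>' M' \<gamma>'"
proof -
  define g where "g = coords i j k \<alpha> M \<gamma>"
  have d: "i \<noteq> j" "i \<noteq> k" "j \<noteq> k" "i' \<noteq> j'" "i' \<noteq> k'" "j' \<noteq> k'"
    using fl by (auto simp: flag_def)
  have g: "g i = \<alpha> + (M - \<gamma>) / 2 + \<gamma> / 3" "g j = (M - \<gamma>) / 2 + \<gamma> / 3" "g k = \<gamma> / 3"
    "\<And>l. l \<notin> {i, j, k} \<Longrightarrow> g l = 0"
    using d unfolding g_def coords_def by auto
  have g': "g i' = \<alpha>' + (M' - \<gamma>') / 2 + \<gamma>' / 3" "g j' = (M' - \<gamma>') / 2 + \<gamma>' / 3" "g k' = \<gamma>' / 3"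
    "\<And>l. l \<notin> {i', j', k'} \<Longrightarrow> g l = 0"
    using d unfolding g_def eq coords_def by auto
  have ord: "g i \<ge> g j" "g j \<ge> g k" "g k \<ge> 0" "g i' \<ge> g j'" "g j' \<ge> g k'" "g k' \<ge> 0"
    using g g' nn by auto
  have val: "\<alpha> = g i - g j" "\<gamma> = 3 * g k" "M = 2 * (g j - g k) + 3 * g k"
    "\<alpha>' = g i' - g j'" "\<gamma>' = 3 * g k'" "M' = 2 * (g j' - g k') + 3 * g k'"
    using g g' by (auto simp: field_simps)
  have pos: "g l > 0 \<Longrightarrow> l \<in> {i, j, k}" "g l > 0 \<Longrightarrow> l \<in> {i', j', k'}" for l
    using g(4) g'(4) by fastforce+
  show ?thesis
  proof (cases "g k = 0")
    case False
    then have "{i, j, k} \<subseteq> {i', j', k'}" using ord pos(2) by force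
    then have same: "{i, j, k} = {i', j', k'}"
      using d by (intro card_subset_eq) auto
    \<comment> \<open>Both orderings of the triple sort \<open>g\<close>: they agree, or differ in
      the first two or in the last two entries, or all three values coincide.\<close>
    consider "i = i'" "j = j'" "k = k'" | "i = j'" "j = i'" "k = k'" | "i = i'" "j = k'" "k = j'"
      | "g i = g j" "g j = g k"
    proof -
      have mem: "i \<in> {i', j', k'}" "j \<in> {i', j', k'}" "k \<in> {i', j', k'}"
        using same by blast+
      then have "i = i' \<and> j = j' \<and> k = k' \<or> i = j' \<and> j = i' \<and> k = k' \<or>
          i = i' \<and> j = k' \<and> k = j' \<or> k = i' \<or> i = k'"
        using d by auto
      moreover have "g i \<le> g i'" "g k' \<le> g k"
        using mem ord by auto
      then have "k = i' \<or> i = k' \<Longrightarrow> g i = g j \<and> g j = g k"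
        using ord by auto
      ultimately show ?thesis using that by blast
    qed
    then show ?thesis
    proof cases
      case 1
      then show ?thesis using val by simp
    next
      case 2
      then have "g i = g j" using ord by auto
      then show ?thesis using 2 val fan_point_swap by simp
    next
      case 3
      then have "g j = g k" using ord by auto
      then have "\<gamma> = M" "\<gamma>' = M'" "\<alpha> = \<alpha>'" "M = M'" using 3 val by auto
      moreover have "P {i, j} k (len {i, j} k) = P {i', j'} k' (len {i', j'} k')"
        using P_end[OF fl same] .
      ultimately show ?thesis
        using fan_point_foot[OF fl(1), of M] fan_point_foot[OF fl(2), of M] 3 nn by auto
    next
      case 4
      have "i' \<in> {i, j, k}" "j' \<in> {i, j, k}" "k' \<in> {i, j, k}" using same by auto
      then have "g i' = g k" "g j' = g k" "g k' = g k" using 4 by auto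
      then have *: "\<gamma> = M" "\<gamma>' = M" "M' = M" "\<alpha> = 0" "\<alpha>' = 0" using 4 val by auto
      have "P {i, j} k (len {i, j} k) = P {i', j'} k' (len {i', j'} k')"
        using P_end[OF fl same] .
      then show ?thesis
        using fan_point_foot[OF fl(1), of M] fan_point_foot[OF fl(2), of M] nn * by auto
    qed
  next
    case True
    \<comment> \<open>The support of \<open>g\<close> has at most two elements, so the smallest
      coordinate of the other description vanishes as well.\<close>
    have "g k' = 0"
    proof (rule ccontr)
      assume "g k' \<noteq> 0"
      then have "{i', j', k'} \<subseteq> {i, j, k} - {k}" using ord pos(1) True by force
      then have "card {i', j', k'} \<le> card ({i, j, k} - {k})" by (intro card_mono) auto
      then show False using d by auto
    qed
    then have \<gamma>: "\<gamma> = 0" "\<gamma>' = 0" using True val by auto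
    have pi: "g i > 0" "g i' > 0"
      using nn g g' \<gamma> by auto
    have fp: "fan_point i j k \<alpha> M \<gamma> u = \<alpha> * of_bool (u = v i) + M * of_bool (u = P {i, j} k 0)"
      "fan_point i' j' k' \<alpha>' M' \<gamma>' u = \<alpha>' * of_bool (u = v i') + M' * of_bool (u = P {i', j'} k' 0)" for u
      using fan_point_center[OF fl(1), of M] fan_point_center[OF fl(2), of M'] \<gamma> nn by auto
    have in3: "i \<in> {i', j', k'}" "i' \<in> {i, j, k}" using pos pi by auto
    show ?thesis
    proof (cases "g j = 0")
      case True
      then have "i' = i" using in3 pi \<open>g k = 0\<close> by auto
      moreover have "g j' = 0"
      proof (rule ccontr)
        assume "g j' \<noteq> 0"
        then have "j' \<in> {i, j, k}" using pos ord by force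
        then show False using \<open>g j' \<noteq> 0\<close> True \<open>g k = 0\<close> \<open>i' = i\<close> d by auto
      qed
      ultimately show ?thesis using fp val True \<open>g k = 0\<close> \<open>g k' = 0\<close> by (auto simp: fun_eq_iff)
    next
      case False
      then have "j \<in> {i', j', k'}" using pos ord by force
      then have "{i, j} = {i', j'}"
        using in3 pi False \<open>g k' = 0\<close> d by auto
      then consider "i = i'" "j = j'" | "i = j'" "j = i'" by (auto simp: doubleton_eq_iff)
      then show ?thesis
      proof cases
        case 1
        then show ?thesis
          using P_start[of i j k k'] fl fp val \<open>g k = 0\<close> \<open>g k' = 0\<close> by (auto simp: fun_eq_iff)
      next
        case 2
        then have "g i = g j" using ord by auto
        then show ?thesis
          using 2 P_start[of i j k k'] fl fp val \<open>g k = 0\<close> \<open>g k' = 0\<close> \<open>{i, j} = {i', j'}\<close>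
          by (auto simp: fun_eq_iff flag_def)
      qed
    qed
  qed
qed

lemma coords_in_complete3:
  assumes fl: "flag t i j k" and nn: "0 \<le> \<alpha>" "0 \<le> \<gamma>" "\<gamma> \<le> M" "\<alpha> + M = 1"
  shows "coords i j k \<alpha> M \<gamma> \<in> realization (complete3 t)"
proof -
  have "coords i j k \<alpha> M \<gamma> \<in> simplex_realization {i, j, k}"
    using fl nn by (auto simp: simplex_realization_def coords_def flag_def)
  moreover have "{i, j, k} \<in> complete3 t"
    using fl by (auto simp: complete3_def flag_def)
  ultimately show ?thesis unfolding realization_def by blast
qed

text \<open>Sorting the three coordinates yields the flag; the parameters come from
  \<open>g i - g j\<close>, \<open>g j - g k\<close> and \<open>g k\<close>.\<close>

lemma realization_complete3E:
  assumes "g \<in> realization (complete3 t)"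
  obtains i j k \<alpha> M \<gamma> where "flag t i j k" "0 \<le> \<alpha>" "0 \<le> \<gamma>" "\<gamma> \<le> M" "\<alpha> + M = 1"
    "g = coords i j k \<alpha> M \<gamma>"
proof -
  obtain \<sigma> where \<sigma>: "\<sigma> \<subseteq> {0..<t}" "card \<sigma> = 3" "g \<in> simplex_realization \<sigma>"
    using assms unfolding realization_def complete3_def by blast
  obtain i j k where ijk: "\<sigma> = {i, j, k}" "i \<noteq> j" "i \<noteq> k" "j \<noteq> k" "g i \<ge> g j" "g j \<ge> g k"
  proof -
    obtain a b c where abc: "\<sigma> = {a, b, c}" "a \<noteq> b" "a \<noteq> c" "b \<noteq> c"
      using \<sigma>(2) by (auto simp: card_3_iff)
    consider "g a \<ge> g b" "g b \<ge> g c" | "g a \<ge> g c" "g c \<ge> g b" | "g b \<ge> g a" "g a \<ge> g c"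
      | "g b \<ge> g c" "g c \<ge> g a" | "g c \<ge> g a" "g a \<ge> g b" | "g c \<ge> g b" "g b \<ge> g a"
      by linarith
    then show ?thesis
    proof cases
      case 1
      then show ?thesis by (intro that[of a b c]) (use abc in auto)
    next
      case 2
      then show ?thesis by (intro that[of a c b]) (use abc in auto)
    next
      case 3
      then show ?thesis by (intro that[of b a c]) (use abc in auto)
    next
      case 4
      then show ?thesis by (intro that[of b c a]) (use abc in auto)
    next
      case 5
      then show ?thesis by (intro that[of c a b]) (use abc in auto)
    next
      case 6
      then show ?thesis by (intro that[of c b a]) (use abc in auto)
    qed
  qed
  have fl: "flag t i j k" using ijk \<sigma>(1) by (auto simp: flag_def)
  have s: "g i + g j + g k = 1" "g k \<ge> 0" "\<And>l. l \<notin> {i, j, k} \<Longrightarrow> g l = 0"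
    using \<sigma>(3) ijk by (auto simp: simplex_realization_def)
  have g: "g = coords i j k (g i - g j) (2 * (g j - g k) + 3 * g k) (3 * g k)"
    using s ijk by (auto simp: coords_def fun_eq_iff field_simps)
  show ?thesis
    by (rule that[OF fl _ _ _ _ g]) (use s ijk in auto)
qed

lemma fans_homeomorphic_complete3:
  "realization_space fans homeomorphic_space realization_space (complete3 t)"
proof (rule homeomorphic_realization_spaceI[where \<Phi> = \<Phi>])
  show "continuous_on (realization fans) \<Phi>"
    by (intro continuous_on_coordinatewise_then_product)
      (auto simp: \<Phi>_def intro!: continuous_intros
        intro: continuous_on_subset[OF continuous_on_product_coordinates])
  show "\<Phi> ` realization fans = realization (complete3 t)"
  proof (intro equalityI subsetI)
    fix g assume "g \<in> \<Phi> ` realization fans"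
    then obtain f where "f \<in> realization fans" "g = \<Phi> f" by blast
    then show "g \<in> realization (complete3 t)"
      by (elim realization_fansE) (simp add: coords_in_complete3)
  next
    fix g assume "g \<in> realization (complete3 t)"
    then show "g \<in> \<Phi> ` realization fans"
      by (elim realization_complete3E) (simp add: coords_in_image)
  qed
  show "inj_on \<Phi> (realization fans)"
  proof (rule inj_onI)
    fix f f' assume f: "f \<in> realization fans" "f' \<in> realization fans" and eq: "\<Phi> f = \<Phi> f'"
    obtain i j k \<alpha> M \<gamma> where 1: "flag t i j k" "0 \<le> \<alpha>" "0 \<le> \<gamma>" "\<gamma> \<le> M" "\<alpha> + M = 1"
      "f = fan_point i j k \<alpha> M \<gamma>" "\<Phi> f = coords i j k \<alpha> M \<gamma>"
      by (rule realization_fansE[OF f(1)])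
    obtain i' j' k' \<alpha>' M' \<gamma>' where 2: "flag t i' j' k'" "0 \<le> \<alpha>'" "0 \<le> \<gamma>'" "\<gamma>' \<le> M'"
      "\<alpha>' + M' = 1" "f' = fan_point i' j' k' \<alpha>' M' \<gamma>'" "\<Phi> f' = coords i' j' k' \<alpha>' M' \<gamma>'"
      by (rule realization_fansE[OF f(2)])
    have "coords i j k \<alpha> M \<gamma> = coords i' j' k' \<alpha>' M' \<gamma>'"
      using eq 1(7) 2(7) by argo
    then have "fan_point i j k \<alpha> M \<gamma> = fan_point i' j' k' \<alpha>' M' \<gamma>'"
      by (rule fan_point_eq_of_coords[OF 1(1) 2(1) 1(2-5) 2(2-5)])
    then show "f = f'" using 1(6) 2(6) by argo
  qed
qed (use finite_fans finite_fan in auto)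

end

section \<open>Decomposition of graphs into expanders\<close>

definition graph_on :: "nat set \<Rightarrow> nat set set \<Rightarrow> bool" where
  "graph_on V E \<longleftrightarrow> finite V \<and> (\<forall>e\<in>E. e \<subseteq> V \<and> card e = 2)"

definition deg :: "nat set set \<Rightarrow> nat \<Rightarrow> nat" where
  "deg E u = card {e \<in> E. u \<in> e}"

definition vol :: "nat set set \<Rightarrow> nat set \<Rightarrow> nat" where
  "vol E U = (\<Sum>u\<in>U. deg E u)"

definition cut :: "nat set set \<Rightarrow> nat set \<Rightarrow> nat set set" where
  "cut E U = {e \<in> E. e \<inter> U \<noteq> {} \<and> \<not> e \<subseteq> U}"

text \<open>Adjacency outside \<open>S\<close>, written as a relation so that walks of length
  \<open>r\<close> are relational powers.\<close>

definition avoid :: "nat set set \<Rightarrow> nat set \<Rightarrow> (nat \<times> nat) set" where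
  "avoid E S = {(a, b). {a, b} \<in> E \<and> a \<notin> S \<and> b \<notin> S}"

lemma graph_on_finite: "graph_on V E \<Longrightarrow> finite E"
  unfolding graph_on_def by (meson Pow_iff finite_Pow_iff finite_subset subsetI)

lemma graph_on_subset: "graph_on V E \<Longrightarrow> F \<subseteq> E \<Longrightarrow> graph_on V F"
  by (auto simp: graph_on_def)

lemma vol_eq:
  assumes E: "graph_on V E" and U: "U \<subseteq> V"
  shows "vol E U = 2 * card {e \<in> E. e \<subseteq> U} + card (cut E U)"
proof -
  have fin: "finite E" "finite U"
    using graph_on_finite[OF E] E U finite_subset by (auto simp: graph_on_def)
  have "vol E U = (\<Sum>u\<in>U. \<Sum>e\<in>E. of_bool (u \<in> e))"
    unfolding vol_def deg_def using fin by (simp add: sum.If_cases Int_def of_bool_def)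
  also have "\<dots> = (\<Sum>e\<in>E. card (e \<inter> U))"
    using fin by (subst sum.swap) (simp add: sum.If_cases Int_def of_bool_def conj_commute)
  also have "\<dots> = (\<Sum>e\<in>E. 2 * of_bool (e \<subseteq> U) + of_bool (e \<in> cut E U))"
  proof (rule sum.cong)
    fix e assume e: "e \<in> E"
    obtain a b where ab: "e = {a, b}" "a \<noteq> b"
      using E e by (auto simp: graph_on_def card_2_iff)
    show "card (e \<inter> U) = 2 * of_bool (e \<subseteq> U) + of_bool (e \<in> cut E U)"
      using e ab by (cases "a \<in> U"; cases "b \<in> U") (auto simp: cut_def)
  qed simp
  also have "\<dots> = 2 * card {e \<in> E. e \<subseteq> U} + card (cut E U)"
  proof -
    have "E \<inter> {e. e \<in> cut E U} = cut E U" by (auto simp: cut_def)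
    then show ?thesis using fin
      by (simp add: sum.distrib sum_distrib_left[symmetric] Int_def of_bool_def sum.If_cases)
  qed
  finally show ?thesis .
qed

lemma vol_all:
  assumes E: "graph_on V E"
  shows "vol E V = 2 * card E"
proof -
  have "{e \<in> E. e \<subseteq> V} = E" "cut E V = {}"
    using E by (auto simp: graph_on_def cut_def)
  then show ?thesis using vol_eq[OF E order_refl] by simp
qed

lemma card_edges_between:
  assumes "finite U" "finite S"
  shows "card {e. \<exists>u\<in>U. \<exists>w\<in>S. e = {u, w}} \<le> card U * card S"
proof -
  have "{e. \<exists>u\<in>U. \<exists>w\<in>S. e = {u, w}} = (\<lambda>(u, w). {u, w}) ` (U \<times> S)" by auto
  then show ?thesis
    using card_image_le[of "U \<times> S" "\<lambda>(u, w). {u, w}"] assms by (simp add: card_cartesian_product)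
qed

lemma sym_avoid: "sym (avoid E S)"
  by (auto simp: sym_def avoid_def insert_commute)

lemma relpow_mono:
  fixes R S :: "'a rel"
  assumes "R \<subseteq> S"
  shows "R ^^ n \<subseteq> S ^^ n"
  by (induction n) (use assms in auto)

lemma sym_relpow:
  assumes "sym R" "(a, b) \<in> R ^^ n"
  shows "(b, a) \<in> R ^^ n"
  using assms(2)
proof (induction n arbitrary: b)
  case (Suc n)
  then obtain c where "(a, c) \<in> R ^^ n" "(c, b) \<in> R" by auto
  then show ?case using Suc.IH assms(1) by (meson relpow_Suc_I2 symD)
qed auto

section \<open>Balls in an expander after deletion of few vertices\<close>

definition ball_avoiding :: "nat set set \<Rightarrow> nat set \<Rightarrow> nat \<Rightarrow> nat \<Rightarrow> nat set" where
  "ball_avoiding E S a n = {b. \<exists>k\<le>n. (a, b) \<in> avoid E S ^^ k}"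

lemma ball_avoiding_subset:
  assumes E: "graph_on V E" and a: "a \<in> V - S"
  shows "ball_avoiding E S a n \<subseteq> V - S"
proof -
  have "b \<in> V - S" if "(a, b) \<in> avoid E S ^^ k" for k b
    using that
  proof (induction k arbitrary: b)
    case (Suc k)
    then obtain c where "(c, b) \<in> avoid E S" by auto
    then show ?case using E unfolding avoid_def graph_on_def by blast
  qed (use a in simp)
  then show ?thesis by (auto simp: ball_avoiding_def)
qed

text \<open>A vertex outside \<open>S\<close> sends at most \<open>card S\<close> edges into \<open>S\<close>, at most the fraction
  \<open>1 / (2 * q)\<close> of its degree.  So deleting \<open>S\<close> destroys at most half of the edge expansion,
  however large the degrees in \<open>S\<close> are.\<close>

lemma vol_ball_step:
  assumes E: "graph_on V E"
    and expand: "\<And>U. U \<subseteq> V \<Longrightarrow> vol E U \<le> card E \<Longrightarrow> vol E U \<le> q * card (cut E U)"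
    and deg: "\<And>u. u \<in> V \<Longrightarrow> 2 * q * s \<le> deg E u"
    and S: "finite S" "card S \<le> s" and a: "a \<in> V - S"
    and small: "vol E (ball_avoiding E S a n) \<le> card E"
  shows "(2 * q + 1) * vol E (ball_avoiding E S a n) \<le> 2 * q * vol E (ball_avoiding E S a (Suc n))"
proof -
  let ?B = "ball_avoiding E S a n" and ?B' = "ball_avoiding E S a (Suc n)"
  have finV: "finite V" using E by (simp add: graph_on_def)
  have BV: "?B \<subseteq> V - S" "?B' \<subseteq> V - S" using ball_avoiding_subset[OF E a] by auto
  have fin: "finite ?B" "finite ?B'" "finite E"
    using BV finV graph_on_finite[OF E] by (auto intro: finite_subset)
  have mono: "?B \<subseteq> ?B'" by (auto simp: ball_avoiding_def intro: le_SucI)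
  let ?X = "{e. \<exists>u\<in>?B. \<exists>w\<in>S. e = {u, w}}"
  let ?Y = "\<Union>u\<in>?B' - ?B. {e \<in> E. u \<in> e}"
  \<comment> \<open>An edge leaving the ball either runs into \<open>S\<close> or reaches a new
    vertex of the next ball.\<close>
  have "cut E ?B \<subseteq> ?X \<union> ?Y"
  proof
    fix e assume e: "e \<in> cut E ?B"
    then have "card e = 2" using E by (auto simp: cut_def graph_on_def)
    then obtain u' w' where "e = {u', w'}" by (auto simp: card_2_iff)
    then obtain u w where uw: "e = {u, w}" "u \<in> ?B" "w \<notin> ?B"
      using e that[of u' w'] that[of w' u'] by (auto simp: cut_def)
    show "e \<in> ?X \<union> ?Y"
    proof (cases "w \<in> S")
      case False
      have "u \<notin> S" using uw BV by auto
      obtain k where k: "k \<le> n" "(a, u) \<in> avoid E S ^^ k"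
        using uw by (auto simp: ball_avoiding_def)
      have "(u, w) \<in> avoid E S"
        using e uw False \<open>u \<notin> S\<close> by (auto simp: cut_def avoid_def)
      then have "(a, w) \<in> avoid E S ^^ Suc k" using k by auto
      then have "w \<in> ?B'" using k unfolding ball_avoiding_def by blast
      then show ?thesis using uw e by (auto simp: cut_def)
    qed (use uw in auto)
  qed
  moreover have "finite ?X"
    using finite_subset[of ?X "(\<lambda>(u, w). {u, w}) ` (?B \<times> S)"] fin S by auto
  ultimately have "card (cut E ?B) \<le> card (?X \<union> ?Y)"
    using fin by (intro card_mono) auto
  also have "\<dots> \<le> card ?X + card ?Y" by (rule card_Un_le)
  also have "\<dots> \<le> card ?B * s + vol E (?B' - ?B)"
  proof (intro add_mono)
    show "card ?X \<le> card ?B * s"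
      using card_edges_between[OF fin(1) S(1)] S(2) by (meson le_trans mult_le_mono2)
    show "card ?Y \<le> vol E (?B' - ?B)"
      unfolding vol_def deg_def using fin by (intro card_UN_le) auto
  qed
  finally have cut: "card (cut E ?B) \<le> card ?B * s + vol E (?B' - ?B)" .
  \<comment> \<open>Multiplied by \<open>q\<close>, the bound for the edges into \<open>S\<close> is
    at most half the volume of the ball; the new vertices must account for the other half.\<close>
  have "card ?B * (2 * q * s) \<le> vol E ?B"
    unfolding vol_def using sum_bounded_below[of ?B "2 * q * s" "deg E"] deg BV by auto
  then have 1: "2 * (q * (card ?B * s)) \<le> vol E ?B" by (simp add: algebra_simps)
  have "vol E ?B \<le> q * card (cut E ?B)"
    using expand[of ?B] BV small by auto
  also have "\<dots> \<le> q * (card ?B * s) + q * vol E (?B' - ?B)"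
    using cut by (metis distrib_left mult_le_mono2)
  finally have "vol E ?B \<le> 2 * (q * vol E (?B' - ?B))" using 1 by linarith
  moreover have "vol E ?B' = vol E ?B + vol E (?B' - ?B)"
    unfolding vol_def using sum.subset_diff[OF mono fin(2), of "deg E"] by simp
  ultimately show ?thesis by (simp add: algebra_simps)
qed

text \<open>While the volume is at most \<open>card E\<close>, each step multiplies it by at least
  \<open>1 + 1 / (2 * q)\<close>. By Bernoulli, \<open>2 * q\<close> steps double it, so
  \<open>2 * q * l\<close> steps would bring it to \<open>2 ^ l\<close>.\<close>

lemma vol_ball_large:
  assumes E: "graph_on V E" and q: "0 < q"
    and expand: "\<And>U. U \<subseteq> V \<Longrightarrow> vol E U \<le> card E \<Longrightarrow> vol E U \<le> q * card (cut E U)"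
    and deg: "\<And>u. u \<in> V \<Longrightarrow> 2 * q * s \<le> deg E u" "\<And>u. u \<in> V \<Longrightarrow> 0 < deg E u"
    and S: "finite S" "card S \<le> s" and a: "a \<in> V - S"
    and l: "card E < 2 ^ l"
  shows "card E < vol E (ball_avoiding E S a (2 * q * l))"
proof (rule ccontr)
  let ?N = "2 * q * l" and ?B = "ball_avoiding E S a"
  assume "\<not> card E < vol E (?B ?N)"
  moreover have "vol E (?B n) \<le> vol E (?B ?N)" if "n \<le> ?N" for n
  proof -
    have "?B n \<subseteq> ?B ?N"
      unfolding ball_avoiding_def using that by (auto intro: le_trans)
    moreover have "finite (?B ?N)"
      using ball_avoiding_subset[OF E a, of ?N] E by (meson finite_Diff finite_subset graph_on_def)
    ultimately show ?thesis unfolding vol_def by (intro sum_mono2) auto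
  qed
  ultimately have small: "vol E (?B n) \<le> card E" if "n \<le> ?N" for n
    using that by (meson le_trans not_less)
  have "(1 + 1 / (2 * q)) ^ n \<le> real (vol E (?B n))" if "n \<le> ?N" for n
    using that
  proof (induction n)
    case 0
    have "?B 0 = {a}" by (auto simp: ball_avoiding_def)
    then show ?case using deg(2)[of a] a by (simp add: vol_def)
  next
    case (Suc n)
    have "(2 * q + 1) * vol E (?B n) \<le> 2 * q * vol E (?B (Suc n))"
      using vol_ball_step[OF E expand deg(1) S a] small Suc by simp
    then have "real ((2 * q + 1) * vol E (?B n)) \<le> real (2 * q * vol E (?B (Suc n)))"
      by (rule of_nat_mono)
    then have "(1 + 1 / (2 * q)) * real (vol E (?B n)) \<le> real (vol E (?B (Suc n)))"
      using q by (simp add: field_simps)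
    moreover have "(1 + 1 / (2 * q)) * (1 + 1 / (2 * q)) ^ n \<le> (1 + 1 / (2 * q)) * real (vol E (?B n))"
      using Suc by (intro mult_left_mono) auto
    ultimately show ?case by simp
  qed
  from this[of ?N] have "(1 + 1 / (2 * q)) ^ ?N \<le> real (vol E (?B ?N))" by simp
  also have "\<dots> \<le> real (card E)" using small[of ?N] by simp
  finally have "(1 + 1 / (2 * real q)) ^ ?N \<le> real (card E)" by simp
  moreover have "2 \<le> (1 + 1 / (2 * real q)) ^ (2 * q)"
    using Bernoulli_inequality[of "1 / (2 * real q)" "2 * q"] q
      order_trans[of "- 1" 0 "1 / (2 * real q)"] by simp
  then have "2 ^ l \<le> (1 + 1 / (2 * real q)) ^ ?N"
    unfolding power_mult by (intro power_mono) auto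
  ultimately have "2 ^ l \<le> real (card E)" by linarith
  then show False using l by (metis not_le of_nat_le_iff of_nat_numeral of_nat_power)
qed

text \<open>The balls around \<open>a\<close> and \<open>b\<close> each have more than half of the
  total volume \<open>2 * card E\<close>, so they intersect.\<close>

lemma expander_short_path:
  assumes E: "graph_on V E" and q: "0 < q"
    and expand: "\<And>U. U \<subseteq> V \<Longrightarrow> vol E U \<le> card E \<Longrightarrow> vol E U \<le> q * card (cut E U)"
    and deg: "\<And>u. u \<in> V \<Longrightarrow> 2 * q * s \<le> deg E u" "\<And>u. u \<in> V \<Longrightarrow> 0 < deg E u"
    and S: "finite S" "card S \<le> s" and ab: "a \<in> V - S" "b \<in> V - S"
    and l: "card E < 2 ^ l"
  shows "\<exists>r\<le>4 * q * l. (a, b) \<in> avoid E S ^^ r"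
proof -
  let ?A = "ball_avoiding E S a (2 * q * l)" and ?B = "ball_avoiding E S b (2 * q * l)"
  have sub: "?A \<subseteq> V" "?B \<subseteq> V" using ball_avoiding_subset[OF E] ab by auto
  have finV: "finite V" using E by (simp add: graph_on_def)
  have "?A \<inter> ?B \<noteq> {}"
  proof
    assume "?A \<inter> ?B = {}"
    then have "vol E ?A + vol E ?B = vol E (?A \<union> ?B)"
      unfolding vol_def using sub finV finite_subset by (metis sum.union_disjoint)
    also have "\<dots> \<le> vol E V"
      unfolding vol_def using sub finV by (intro sum_mono2) auto
    also have "\<dots> = 2 * card E" by (rule vol_all[OF E])
    finally show False
      using vol_ball_large[OF E q expand deg S ab(1) l] vol_ball_large[OF E q expand deg S ab(2) l]
      by simp
  qed
  then obtain c k m where "k \<le> 2 * q * l" "m \<le> 2 * q * l"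
    "(a, c) \<in> avoid E S ^^ k" "(b, c) \<in> avoid E S ^^ m"
    by (auto simp: ball_avoiding_def)
  then have "(a, b) \<in> avoid E S ^^ (k + m)" "k + m \<le> 4 * q * l"
    using sym_relpow[OF sym_avoid] by (auto simp: relpow_add)
  then show ?thesis by blast
qed

text \<open>Only endpoints connected in \<open>E\<close> have to be joined, and degree 0 is allowed.
  Hence the notion covers disjoint unions of expanders and need not mention a vertex set.\<close>

definition robust :: "nat \<Rightarrow> nat \<Rightarrow> nat \<Rightarrow> nat set set \<Rightarrow> bool" where
  "robust D s L E \<longleftrightarrow> (\<forall>u. deg E u = 0 \<or> D \<le> deg E u) \<and>
     (\<forall>a b S. finite S \<and> card S \<le> s \<and> a \<notin> S \<and> b \<notin> S \<and> (a, b) \<in> (avoid E {})\<^sup>*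
        \<longrightarrow> (\<exists>r\<le>L. (a, b) \<in> avoid E S ^^ r))"

lemma robust_deg: "robust D s L E \<Longrightarrow> deg E u = 0 \<or> D \<le> deg E u"
  unfolding robust_def by blast

lemma robust_path:
  assumes "robust D s L E" "finite S" "card S \<le> s" "a \<notin> S" "b \<notin> S" "(a, b) \<in> (avoid E {})\<^sup>*"
  shows "\<exists>r\<le>L. (a, b) \<in> avoid E S ^^ r"
  using assms unfolding robust_def by blast

lemma rtrancl_disjoint_Un:
  assumes "(a, b) \<in> (R1 \<union> R2)\<^sup>*" "Field R1 \<inter> Field R2 = {}"
  shows "(a, b) \<in> R1\<^sup>* \<or> (a, b) \<in> R2\<^sup>*"
  using assms(1)
proof (induction rule: rtrancl_induct)
  case (step b c)
  have *: "b \<in> Field R" if "(a, b) \<in> R\<^sup>*" "a \<noteq> b" for R :: "'a rel"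
    using that by (metis FieldI2 rtranclE)
  show ?case
  proof (cases "a = b")
    case False
    have "b \<in> Field R1 \<or> (b, c) \<in> R2" "b \<in> Field R2 \<or> (b, c) \<in> R1"
      using step(2) FieldI1 by fastforce+
    moreover have "b \<notin> Field R1 \<or> b \<notin> Field R2" using assms(2) by blast
    moreover have "(b, c) \<in> R1 \<Longrightarrow> b \<in> Field R1" "(b, c) \<in> R2 \<Longrightarrow> b \<in> Field R2"
      by (auto intro: FieldI1)
    ultimately have "(a, b) \<in> R1\<^sup>* \<and> (b, c) \<in> R1 \<or> (a, b) \<in> R2\<^sup>* \<and> (b, c) \<in> R2"
      using step.IH *[OF _ False] by blast
    then show ?thesis by (meson rtrancl.rtrancl_into_rtrancl)
  qed (use step in auto)
qed simp

text \<open>Degrees do not change under a vertex-disjoint union, and no walk passes from one part to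
  the other.\<close>

lemma robust_Un:
  assumes r: "robust D s L F1" "robust D s L F2" and disj: "\<Union>F1 \<inter> \<Union>F2 = {}"
  shows "robust D s L (F1 \<union> F2)"
proof -
  have "deg (F1 \<union> F2) u = 0 \<or> D \<le> deg (F1 \<union> F2) u" for u
  proof -
    have "{e \<in> F1 \<union> F2. u \<in> e} = {e \<in> F1. u \<in> e} \<or> {e \<in> F1 \<union> F2. u \<in> e} = {e \<in> F2. u \<in> e}"
      using disj by blast
    then have "deg (F1 \<union> F2) u = deg F1 u \<or> deg (F1 \<union> F2) u = deg F2 u"
      unfolding deg_def by presburger
    moreover have "deg F1 u = 0 \<or> D \<le> deg F1 u" "deg F2 u = 0 \<or> D \<le> deg F2 u"
      using r unfolding robust_def by blast+
    ultimately show ?thesis by metis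
  qed
  moreover have "\<exists>r\<le>L. (a, b) \<in> avoid (F1 \<union> F2) S ^^ r"
    if S: "finite S" "card S \<le> s" "a \<notin> S" "b \<notin> S" and conn: "(a, b) \<in> (avoid (F1 \<union> F2) {})\<^sup>*"
    for a b S
  proof -
    have "avoid (F1 \<union> F2) {} = avoid F1 {} \<union> avoid F2 {}" by (auto simp: avoid_def)
    moreover have "Field (avoid F1 {}) \<inter> Field (avoid F2 {}) = {}"
      using disj by (auto simp: avoid_def Field_def)
    ultimately have "(a, b) \<in> (avoid F1 {})\<^sup>* \<or> (a, b) \<in> (avoid F2 {})\<^sup>*"
      using rtrancl_disjoint_Un conn by metis
    then obtain r F where F: "r \<le> L" "(a, b) \<in> avoid F S ^^ r" "F = F1 \<or> F = F2"
      using robust_path[OF r(1) S] robust_path[OF r(2) S] by blast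
    moreover have "avoid F S \<subseteq> avoid (F1 \<union> F2) S"
      using F(3) by (auto simp: avoid_def)
    ultimately have "(a, b) \<in> avoid (F1 \<union> F2) S ^^ r"
      using F(2) relpow_mono by blast
    then show ?thesis using F(1) by blast
  qed
  ultimately show ?thesis unfolding robust_def by blast
qed

text \<open>Peel off vertices of degree below \<open>D\<close>, and split along cuts sparser than \<open>1 / q\<close>.  The
  edges of such a cut are paid for by the smaller side, whose number of edges at least halves, so
  every edge pays at most \<open>l\<close> times.\<close>

lemma robust_decomposition:
  assumes "graph_on V E" and q: "0 < q" and D: "2 * q * s \<le> D" "0 < D"
    and "card E < 2 ^ l" "l \<le> m"
  shows "\<exists>F\<subseteq>E. robust D s (4 * q * m) F \<and>
    q * card (E - F) \<le> q * D * card V + 2 * l * card E"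
  using assms(1,5,6)
proof (induction "card V" arbitrary: V E l rule: less_induct)
  case less
  note E = less.prems(1)
  have fin: "finite V" "finite E" using E graph_on_finite[OF E] by (auto simp: graph_on_def)
  consider v where "v \<in> V" "deg E v < D"
    | U where "U \<subseteq> V" "vol E U \<le> card E" "q * card (cut E U) < vol E U"
    | "\<And>v. v \<in> V \<Longrightarrow> D \<le> deg E v"
      "\<And>U. U \<subseteq> V \<Longrightarrow> vol E U \<le> card E \<Longrightarrow> vol E U \<le> q * card (cut E U)"
    by (meson not_le)
  then show ?case
  proof cases
    case 1
    define E1 where "E1 = {e \<in> E. v \<notin> e}"
    have "graph_on (V - {v}) E1" using E by (auto simp: graph_on_def E1_def)
    moreover have "card E1 \<le> card E" using fin by (auto simp: E1_def intro: card_mono)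
    moreover have cV: "card V = Suc (card (V - {v}))"
      using 1 fin by (metis card_Suc_Diff1)
    ultimately obtain F where F: "F \<subseteq> E1" "robust D s (4 * q * m) F"
      "q * card (E1 - F) \<le> q * D * card (V - {v}) + 2 * l * card E1"
      using less.hyps[of "V - {v}" E1 l] less.prems by auto
    \<comment> \<open>The fewer than \<open>D\<close> edges at \<open>v\<close> are paid for by the
      share \<open>q * D\<close> of the vertex \<open>v\<close>.\<close>
    have "E - F = (E1 - F) \<union> {e \<in> E. v \<in> e}" using F by (auto simp: E1_def)
    then have "card (E - F) \<le> card (E1 - F) + D"
      using card_Un_le[of "E1 - F" "{e \<in> E. v \<in> e}"] 1 by (simp add: deg_def)
    then have "q * card (E - F) \<le> q * card (E1 - F) + q * D"
      by (metis distrib_left mult_le_mono2)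
    also have "\<dots> \<le> q * D * card V + 2 * l * card E1" using F(3) cV by simp
    also have "\<dots> \<le> q * D * card V + 2 * l * card E" using \<open>card E1 \<le> card E\<close> by simp
    finally show ?thesis using F by (auto simp: E1_def)
  next
    case 2
    have E_ne: "card E > 0"
    proof (rule ccontr)
      assume "\<not> 0 < card E"
      then have "E = {}" using fin by simp
      then show False using 2(3) by (simp add: vol_def deg_def)
    qed
    have U: "U \<noteq> {}" "U \<noteq> V" using 2 E_ne vol_all[OF E] by (auto simp: vol_def)
    define E1 where "E1 = {e \<in> E. e \<subseteq> U}"
    define E2 where "E2 = {e \<in> E. e \<subseteq> V - U}"
    have split: "E = E1 \<union> E2 \<union> cut E U"
      using E by (auto simp: E1_def E2_def cut_def graph_on_def)
    have vol: "vol E U = 2 * card E1 + card (cut E U)"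
      using vol_eq[OF E 2(1)] by (simp add: E1_def)
    have cE: "card E = card E1 + card E2 + card (cut E U)"
    proof -
      have "{} \<notin> E" using E by (auto simp: graph_on_def)
      then have "e \<notin> E2" if "e \<in> E1" for e
        using that by (cases "e = {}") (auto simp: E1_def E2_def)
      then have "E1 \<inter> E2 = {}" "(E1 \<union> E2) \<inter> cut E U = {}"
        by (auto simp: E1_def E2_def cut_def)
      then show ?thesis
        using split fin by (metis card_Un_disjoint finite_Un)
    qed
    \<comment> \<open>As \<open>vol E U\<close> is at most \<open>card E\<close>, the part
      \<open>E1\<close> has at most half of the edges, and its exponent drops by one.\<close>
    obtain l' where l': "l = Suc l'"
      using E_ne less.prems(2) by (cases l) auto
    have "graph_on U E1" "graph_on (V - U) E2"
      using E 2(1) finite_subset by (auto simp: graph_on_def E1_def E2_def)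
    moreover have "card E1 < 2 ^ l'" "card E2 < 2 ^ l"
      using vol 2(2) less.prems(2) cE l' by auto
    moreover have cV: "card V = card U + card (V - U)"
      using fin 2(1) by (metis card_Diff_subset card_mono finite_subset le_add_diff_inverse)
    moreover have "card U < card V" "card (V - U) < card V"
      using U 2(1) fin by (auto intro!: psubset_card_mono)
    ultimately obtain F1 F2 where F: "F1 \<subseteq> E1" "robust D s (4 * q * m) F1"
      "q * card (E1 - F1) \<le> q * D * card U + 2 * l' * card E1"
      "F2 \<subseteq> E2" "robust D s (4 * q * m) F2"
      "q * card (E2 - F2) \<le> q * D * card (V - U) + 2 * l * card E2"
      using less.hyps[of U E1 l'] less.hyps[of "V - U" E2 l] less.prems(3) l' by auto
    have "robust D s (4 * q * m) (F1 \<union> F2)"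
      using F by (intro robust_Un) (auto simp: E1_def E2_def)
    moreover have "F1 \<union> F2 \<subseteq> E" using F split by blast
    moreover have "q * card (E - (F1 \<union> F2)) \<le> q * D * card V + 2 * l * card E"
    proof -
      have "E - (F1 \<union> F2) \<subseteq> (E1 - F1) \<union> (E2 - F2) \<union> cut E U" using split by blast
      then have "card (E - (F1 \<union> F2)) \<le> card ((E1 - F1) \<union> (E2 - F2) \<union> cut E U)"
        using fin by (intro card_mono) (auto simp: E1_def E2_def cut_def)
      also have "\<dots> \<le> card (E1 - F1) + card (E2 - F2) + card (cut E U)"
        by (meson add_mono card_Un_le le_trans order_refl)
      finally have "q * card (E - (F1 \<union> F2))
          \<le> q * card (E1 - F1) + q * card (E2 - F2) + q * card (cut E U)"
        by (metis distrib_left mult_le_mono2)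
      \<comment> \<open>The cut costs less than \<open>2 * card E1 + card (cut E U)\<close>. The
        first term is what lowering \<open>l\<close> to \<open>l'\<close> saves on
        \<open>E1\<close>; the second is covered by the cut edges themselves.\<close>
      also have "\<dots> \<le> q * D * card V + 2 * l' * card E1 + 2 * l * card E2
          + (2 * card E1 + card (cut E U))"
        using F(3,6) 2(3) vol cV by (simp add: algebra_simps)
      also have "\<dots> \<le> q * D * card V + 2 * l * card E"
        using cE l' by (simp add: algebra_simps)
      finally show ?thesis .
    qed
    ultimately show ?thesis by blast
  next
    case 3
    have "\<exists>r\<le>4 * q * m. (a, b) \<in> avoid E S ^^ r"
      if S: "finite S" "card S \<le> s" and ab: "a \<notin> S" "b \<notin> S" and conn: "(a, b) \<in> (avoid E {})\<^sup>*" for a b S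
    proof (cases "a = b")
      case False
      have "Field (avoid E {}) \<subseteq> V" using E by (auto simp: graph_on_def avoid_def Field_def)
      moreover have "a \<in> Field (avoid E {})" "b \<in> Field (avoid E {})"
        using conn False by (metis FieldI1 converse_rtranclE, metis FieldI2 rtranclE)
      ultimately have "a \<in> V" "b \<in> V" by auto
      moreover have deg: "2 * q * s \<le> deg E u" "0 < deg E u" if "u \<in> V" for u
        using 3(1)[OF that] D by linarith+
      \<comment> \<open>Path lengths are measured by the fixed \<open>m\<close> instead of
        \<open>l\<close>, so that all parts satisfy the same bound.\<close>
      moreover have "card E < 2 ^ m"
        using less.prems by (meson less_le_trans one_le_numeral power_increasing)
      ultimately show ?thesis
        using expander_short_path[OF E q 3(2) _ _ S, of a b m] deg ab by auto
    next
      case True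
      then show ?thesis by (intro exI[of _ 0]) auto
    qed
    moreover have "deg E u = 0 \<or> D \<le> deg E u" for u
    proof (cases "u \<in> V")
      case False
      then have "{e \<in> E. u \<in> e} = {}" using E by (auto simp: graph_on_def)
      then show ?thesis unfolding deg_def by (metis card.empty)
    qed (use 3 in auto)
    ultimately have "robust D s (4 * q * m) E" unfolding robust_def by blast
    then show ?thesis by (intro exI[of _ E]) auto
  qed
qed

section \<open>Greedy construction of spiders\<close>

text \<open>The objects are chosen one after another. The set \<open>A\<close> to be avoided
  consists of \<open>S\<close> and the sets chosen so far and never exceeds \<open>s\<close>. This
  serves for feet, hubs and legs.\<close>

lemma greedy_disjoint:
  fixes W :: "'b \<Rightarrow> 'c set"
  assumes "finite I" "finite S" "card S + card I * c \<le> s"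
    and "\<And>i A. i \<in> I \<Longrightarrow> finite A \<Longrightarrow> S \<subseteq> A \<Longrightarrow> card A \<le> s
      \<Longrightarrow> \<exists>x. Q i x \<and> finite (W x) \<and> card (W x) \<le> c \<and> W x \<inter> A = {}"
  shows "\<exists>f. \<forall>i\<in>I. Q i (f i) \<and> finite (W (f i)) \<and> card (W (f i)) \<le> c \<and> W (f i) \<inter> S = {}
    \<and> (\<forall>j\<in>I. j \<noteq> i \<longrightarrow> W (f i) \<inter> W (f j) = {})"
  using assms
proof (induction I rule: finite_induct)
  case (insert i I)
  have "card S + card I * c \<le> s" using insert.prems(2) insert.hyps by simp
  from insert.IH[OF insert.prems(1) this insert.prems(3)[OF insertI2]]
  obtain f where f: "\<forall>i\<in>I. Q i (f i) \<and> finite (W (f i)) \<and> card (W (f i)) \<le> c \<and> W (f i) \<inter> S = {}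
    \<and> (\<forall>j\<in>I. j \<noteq> i \<longrightarrow> W (f i) \<inter> W (f j) = {})" ..
  let ?A = "S \<union> (\<Union>j\<in>I. W (f j))"
  have "card (\<Union>j\<in>I. W (f j)) \<le> (\<Sum>j\<in>I. card (W (f j)))"
    by (rule card_UN_le[OF insert.hyps(1)])
  also have "\<dots> \<le> card I * c"
    using sum_bounded_above[of I "\<lambda>j. card (W (f j))" c] f by simp
  finally have "card (\<Union>j\<in>I. W (f j)) \<le> card I * c" .
  then have "card ?A \<le> s"
    using card_Un_le[of S "\<Union>j\<in>I. W (f j)"] insert by simp
  then obtain x where x: "Q i x" "finite (W x)" "card (W x) \<le> c" "W x \<inter> ?A = {}"
  proof -
    have "finite ?A" using insert.prems(1) insert.hyps(1) f by blast
    then show ?thesis using insert.prems(3)[OF insertI1, of ?A] that \<open>card ?A \<le> s\<close> by blast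
  qed
  have "\<forall>i'\<in>insert i I. Q i' ((f(i := x)) i') \<and> finite (W ((f(i := x)) i'))
      \<and> card (W ((f(i := x)) i')) \<le> c \<and> W ((f(i := x)) i') \<inter> S = {}
      \<and> (\<forall>j\<in>insert i I. j \<noteq> i' \<longrightarrow> W ((f(i := x)) i') \<inter> W ((f(i := x)) j) = {})"
  proof -
    have "W x \<inter> S = {}" "\<And>j. j \<in> I \<Longrightarrow> W x \<inter> W (f j) = {}" "\<And>j. j \<in> I \<Longrightarrow> W (f j) \<inter> W x = {}"
      using x(4) by blast+
    then show ?thesis using f x(1-3) insert.hyps(2) by simp
  qed
  then show ?case by blast
qed simp

text \<open>A walk of least length repeats no vertex, since a repetition could be cut out.\<close>

lemma relpow_simple_path:
  fixes R :: "'a rel"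
  assumes "(a, b) \<in> R ^^ r"
  obtains r' f where "r' \<le> r" "f 0 = a" "f r' = b" "inj_on f {..r'}" "\<And>i. i < r' \<Longrightarrow> (f i, f (Suc i)) \<in> R"
proof -
  define r' where "r' = (LEAST r. (a, b) \<in> R ^^ r)"
  have r': "(a, b) \<in> R ^^ r'" unfolding r'_def by (rule LeastI[of _ r]) (rule assms)
  have min: "r' \<le> k" if "(a, b) \<in> R ^^ k" for k
    unfolding r'_def by (rule Least_le) (rule that)
  obtain f where f: "f 0 = a" "f r' = b" "\<forall>i<r'. (f i, f (Suc i)) \<in> R"
    using r' unfolding relpow_fun_conv by blast
  have "f i \<noteq> f j" if "i < j" "j \<le> r'" for i j
  proof
    assume eq: "f i = f j"
    have "(a, f i) \<in> R ^^ i"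
      unfolding relpow_fun_conv using f that by (intro exI[of _ f]) auto
    moreover have "(f j, b) \<in> R ^^ (r' - j)"
      unfolding relpow_fun_conv using f that by (intro exI[of _ "\<lambda>k. f (j + k)"]) auto
    ultimately have "(a, b) \<in> R ^^ (i + (r' - j))"
      using eq by (auto simp: relpow_add)
    then show False using min that by fastforce
  qed
  then have "inj_on f {..r'}"
    by (metis atMost_iff inj_onI linorder_neqE_nat)
  then show thesis using that f min[OF assms] by blast
qed

definition nbrs :: "nat set set \<Rightarrow> nat \<Rightarrow> nat set" where
  "nbrs E u = {w. {u, w} \<in> E}"

lemma card_nbrs:
  assumes "\<And>e. e \<in> E \<Longrightarrow> card e = 2"
  shows "card (nbrs E u) = deg E u"
proof -
  have "bij_betw (\<lambda>w. {u, w}) (nbrs E u) {e \<in> E. u \<in> e}"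
  proof (rule bij_betwI')
    fix e assume e: "e \<in> {e \<in> E. u \<in> e}"
    then have "card e = 2" using assms by blast
    then obtain a b where "e = {a, b}" by (auto simp: card_2_iff)
    then have "e = {u, b} \<or> e = {u, a}" using e by auto
    then show "\<exists>w\<in>nbrs E u. e = {u, w}" using e by (auto simp: nbrs_def)
  qed (auto simp: nbrs_def doubleton_eq_iff)
  then show ?thesis unfolding deg_def by (rule bij_betw_same_card)
qed

text \<open>The endpoints may belong to \<open>A\<close>. They are removed from the deleted set, and
  simplicity of the path keeps its interior away from them.\<close>

lemma robust_path_through:
  assumes E: "\<And>e. e \<in> E \<Longrightarrow> card e = 2" and rob: "robust D s L E"
    and A: "finite A" "card A \<le> s" and ab: "(a, b) \<in> (avoid E {})\<^sup>*" "a \<noteq> b"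
  obtains f r where "0 < r" "r \<le> L" "f 0 = a" "f r = b" "inj_on f {..r}"
    "\<And>i. i < r \<Longrightarrow> {f i, f (Suc i)} \<in> E" "f ` {0<..<r} \<inter> A = {}"
proof -
  have "card (A - {a, b}) \<le> s" using A by (meson Diff_subset card_mono le_trans)
  then obtain r0 where r0: "r0 \<le> L" "(a, b) \<in> avoid E (A - {a, b}) ^^ r0"
    using robust_path[OF rob, of "A - {a, b}" a b] A ab by auto
  obtain r f where f: "r \<le> r0" "f 0 = a" "f r = b" "inj_on f {..r}"
    "\<And>i. i < r \<Longrightarrow> (f i, f (Suc i)) \<in> avoid E (A - {a, b})"
    using relpow_simple_path[OF r0(2)] by blast
  have "f i \<notin> A" if "0 < i" "i < r" for i
  proof -
    have "f i \<noteq> a" "f i \<noteq> b"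
      using f(2-3) inj_onD[OF f(4), of i 0] inj_onD[OF f(4), of i r] that by auto
    then show ?thesis using f(5)[OF that(2)] by (auto simp: avoid_def)
  qed
  then have "f ` {0<..<r} \<inter> A = {}" by auto
  moreover have "0 < r" using f(2,3) ab(2) by (cases r) auto
  moreover have "{f i, f (Suc i)} \<in> E" if "i < r" for i
    using f(5)[OF that] by (simp add: avoid_def)
  ultimately show thesis
    using that[of r f] f(1-4) r0(1) by simp
qed

section \<open>Disjoint spiders from hubs and legs\<close>

definition pairs :: "nat \<Rightarrow> nat set set" where
  "pairs t = {{i, j} | i j. i < t \<and> j < t \<and> i \<noteq> j}"

definition triples :: "nat \<Rightarrow> nat set set" where
  "triples t = {{i, j, k} | i j k. flag t i j k}"

lemma card_pairs: "finite (pairs t)" "card (pairs t) \<le> t\<^sup>2"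
proof -
  have sub: "pairs t \<subseteq> (\<lambda>(i, j). {i, j}) ` ({..<t} \<times> {..<t})"
    by (auto simp: pairs_def)
  then show "finite (pairs t)" by (rule finite_subset) auto
  have "card (pairs t) \<le> card ((\<lambda>(i, j). {i, j}) ` ({..<t} \<times> {..<t}))"
    by (rule card_mono[OF _ sub]) auto
  also have "\<dots> \<le> card ({..<t} \<times> {..<t})" by (rule card_image_le) auto
  finally show "card (pairs t) \<le> t\<^sup>2" by (simp add: power2_eq_square)
qed

lemma card_triples: "finite (triples t)" "card (triples t) \<le> t ^ 3"
proof -
  have sub: "triples t \<subseteq> (\<lambda>(i, j, k). {i, j, k}) ` ({..<t} \<times> {..<t} \<times> {..<t})"
  proof
    fix \<tau> assume "\<tau> \<in> triples t"
    then obtain i j k where "\<tau> = {i, j, k}" "(i, j, k) \<in> {..<t} \<times> {..<t} \<times> {..<t}"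
      by (auto simp: triples_def flag_def)
    then show "\<tau> \<in> (\<lambda>(i, j, k). {i, j, k}) ` ({..<t} \<times> {..<t} \<times> {..<t})" by force
  qed
  then show "finite (triples t)" by (rule finite_subset) auto
  have "card (triples t) \<le> card ((\<lambda>(i, j, k). {i, j, k}) ` ({..<t} \<times> {..<t} \<times> {..<t}))"
    by (rule card_mono[OF _ sub]) auto
  also have "\<dots> \<le> card ({..<t} \<times> {..<t} \<times> {..<t})" by (rule card_image_le) auto
  finally show "card (triples t) \<le> t ^ 3" by (simp add: power3_eq_cube)
qed

text \<open>The feet \<open>x\<close> are all adjacent to \<open>y\<close> in the relevant
  subgraphs, which puts the feet for one pair into one component. \<open>D\<close> exceeds the
  number of vertices in anchors and hubs by more than \<open>t\<close>; \<open>s\<close> also has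
  room for the interiors of \<open>t ^ 3\<close> legs.\<close>

locale anchored =
  fixes t D s L :: nat and H :: "nat set set" and F :: "nat set \<Rightarrow> nat set set"
    and v :: "nat \<Rightarrow> nat" and x :: "nat set \<Rightarrow> nat" and y :: nat
  assumes t: "3 \<le> t"
    and inj_v: "inj_on v {..<t}"
    and F_link: "\<lbrakk>i < t; j < t; i \<noteq> j; p \<in> F {i, j}\<rbrakk> \<Longrightarrow> card p = 2 \<and> insert (v i) p \<in> H"
    and rob: "e \<in> pairs t \<Longrightarrow> robust D s L (F e)"
    and fin_F: "e \<in> pairs t \<Longrightarrow> finite (F e)"
    and xy: "flag t i j k \<Longrightarrow> {x {i, j, k}, y} \<in> F {i, j}"
    and inj_x: "inj_on x (triples t)"
    and x_v: "\<tau> \<in> triples t \<Longrightarrow> i < t \<Longrightarrow> x \<tau> \<noteq> v i"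
    and D: "t + t ^ 3 + 1 + t\<^sup>2 * (t + 1) + t + 1 \<le> D"
    and s: "t + t ^ 3 + 1 + t\<^sup>2 * (t + 1) + t ^ 3 * L \<le> s"
begin

definition anchors :: "nat set" where
  "anchors = v ` {..<t} \<union> x ` triples t \<union> {y}"

text \<open>A hub is the centre \<open>w\<close> of a spider together with neighbours
  \<open>g k\<close> of \<open>w\<close>, where \<open>g k\<close> is the first vertex of leg
  \<open>k\<close>.\<close>

definition hub_set :: "nat \<times> (nat \<Rightarrow> nat) \<Rightarrow> nat set" where
  "hub_set = (\<lambda>(w, g). insert w (g ` {..<t}))"

definition is_hub :: "nat set \<Rightarrow> nat \<times> (nat \<Rightarrow> nat) \<Rightarrow> bool" where
  "is_hub e = (\<lambda>(w, g). inj_on g {..<t} \<and> (\<forall>k<t. {w, g k} \<in> F e) \<and>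
     (\<forall>k<t. k \<notin> e \<longrightarrow> (g k, x (insert k e)) \<in> (avoid (F e) {})\<^sup>*))"

text \<open>Only the interior counts, because one end lies in the hub and the other is a foot shared
  by three spiders.\<close>

definition leg_set :: "(nat \<Rightarrow> nat) \<times> nat \<Rightarrow> nat set" where
  "leg_set = (\<lambda>(f, r). f ` {0<..<r})"

definition is_leg :: "nat set \<Rightarrow> nat \<Rightarrow> nat \<Rightarrow> (nat \<Rightarrow> nat) \<times> nat \<Rightarrow> bool" where
  "is_leg e k a = (\<lambda>(f, r). 0 < r \<and> r \<le> L \<and> f 0 = a \<and> f r = x (insert k e) \<and> inj_on f {..r} \<and>
     (\<forall>i<r. {f i, f (Suc i)} \<in> F e))"

lemma F_card: "e \<in> pairs t \<Longrightarrow> p \<in> F e \<Longrightarrow> card p = 2"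
  using F_link unfolding pairs_def by blast

lemma finite_anchors: "finite anchors"
  using card_triples by (auto simp: anchors_def)

lemma card_anchors: "card anchors \<le> t + t ^ 3 + 1"
proof -
  have "card anchors \<le> card (v ` {..<t} \<union> x ` triples t) + card {y}"
    unfolding anchors_def by (rule card_Un_le)
  also have "\<dots> \<le> card (v ` {..<t}) + card (x ` triples t) + card {y}"
    by (intro add_right_mono card_Un_le)
  also have "\<dots> \<le> t + t ^ 3 + 1"
    using card_image_le[of "{..<t}" v] card_image_le[of "triples t" x] card_triples[of t]
    by auto
  finally show ?thesis .
qed

lemma flag_of_pair:
  assumes "e \<in> pairs t" "k < t" "k \<notin> e"
  obtains i j where "e = {i, j}" "flag t i j k" "insert k e = {i, j, k}" "insert k e \<in> triples t"
proof -
  obtain i j where ij: "e = {i, j}" "i < t" "j < t" "i \<noteq> j" using assms by (auto simp: pairs_def)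
  have fl: "flag t i j k" and ins: "insert k e = {i, j, k}" using ij assms by (auto simp: flag_def)
  have "insert k e \<in> triples t" unfolding ins triples_def using fl by blast
  then show thesis using that[OF ij(1) fl ins] by simp
qed

text \<open>The minimum degree \<open>D\<close> leaves a neighbour \<open>w\<close> of
  \<open>y\<close> outside \<open>A\<close>, and then \<open>t\<close> neighbours of
  \<open>w\<close> outside \<open>A\<close>. They reach the feet through \<open>w\<close> and
  \<open>y\<close>.\<close>

lemma hub_exists:
  assumes e: "e \<in> pairs t" and A: "finite A" "anchors \<subseteq> A" "card A \<le> t + t ^ 3 + 1 + t\<^sup>2 * (t + 1)"
  shows "\<exists>h. is_hub e h \<and> finite (hub_set h) \<and> card (hub_set h) \<le> t + 1 \<and> hub_set h \<inter> A = {}"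
proof -
  have avoid0: "(a, b) \<in> avoid (F e) {} \<longleftrightarrow> {a, b} \<in> F e" for a b by (simp add: avoid_def)
  have e2: "card e = 2" using e by (auto simp: pairs_def)
  have edge: "{x (insert k e), y} \<in> F e" if "k < t" "k \<notin> e" for k
    using flag_of_pair[OF e that] xy by metis
  have big: "\<exists>B\<subseteq>nbrs (F e) u - A. card B = t" if "deg (F e) u \<noteq> 0" for u
  proof -
    have "D \<le> card (nbrs (F e) u)"
      using robust_deg[OF rob[OF e], of u] that card_nbrs[of "F e" u] F_card[OF e] by auto
    then have "t \<le> card (nbrs (F e) u - A)"
      using diff_card_le_card_Diff[OF A(1), of "nbrs (F e) u"] A(3) D by linarith
    then show ?thesis using obtain_subset_with_card_n by metis
  qed
  have pos: "deg (F e) u \<noteq> 0" if "{u, w} \<in> F e" for u w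
    using that fin_F[OF e] by (auto simp: deg_def)
  have sym: "{a, b} \<in> F e \<Longrightarrow> {b, a} \<in> F e" for a b by (simp add: insert_commute)
  \<comment> \<open>Since \<open>t\<close> is at least 3, some triple contains \<open>e\<close>; its
    foot shows that \<open>y\<close> has positive degree, hence degree at least
    \<open>D\<close>.\<close>
  obtain k0 where k0: "k0 < t" "k0 \<notin> e"
  proof -
    have "card e < card {..<t}" using e2 t by simp
    then have "\<not> {..<t} \<subseteq> e" using card_mono[of e "{..<t}"] e2 card.infinite by force
    then show thesis using that by auto
  qed
  have "deg (F e) y \<noteq> 0" using pos sym edge[OF k0] by blast
  then obtain B where B: "B \<subseteq> nbrs (F e) y - A" "card B = t" using big by blast
  then obtain w where w: "w \<in> nbrs (F e) y" "w \<notin> A"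
    using t by (metis DiffD1 DiffD2 card.empty ex_in_conv not_numeral_le_zero subsetD)
  have wy: "{w, y} \<in> F e" using w sym by (simp add: nbrs_def)
  obtain B' where B': "B' \<subseteq> nbrs (F e) w - A" "card B' = t" using big[OF pos[OF wy]] by blast
  have "finite B'" using B' t by (metis card.infinite not_numeral_le_zero)
  then obtain g where g: "bij_betw g {..<t} B'"
    using B'(2) by (metis bij_betw_iff_card card_lessThan finite_lessThan)
  have gk: "{w, g k} \<in> F e" "g k \<notin> A" if "k < t" for k
    using that g B' bij_betwE[OF g] by (auto simp: nbrs_def)
  have "(g k, x (insert k e)) \<in> (avoid (F e) {})\<^sup>*" if "k < t" "k \<notin> e" for k
  proof -
    have "(g k, w) \<in> avoid (F e) {}" "(w, y) \<in> avoid (F e) {}" "(y, x (insert k e)) \<in> avoid (F e) {}"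
      using gk(1)[OF that(1)] wy edge[OF that] sym unfolding avoid0 by auto
    then show ?thesis by (meson converse_rtrancl_into_rtrancl r_into_rtrancl)
  qed
  then have "is_hub e (w, g)"
    using g gk(1) by (auto simp: is_hub_def bij_betw_def)
  moreover have "card (hub_set (w, g)) \<le> t + 1"
    using card_insert_le_m1[of "t + 1" "g ` {..<t}" w] card_image_le[of "{..<t}" g]
    by (simp add: hub_set_def card_insert_if)
  moreover have "hub_set (w, g) \<inter> A = {}" "finite (hub_set (w, g))"
    using w gk by (auto simp: hub_set_def)
  ultimately show ?thesis by blast
qed

lemma leg_exists:
  assumes e: "e \<in> pairs t" and k: "k < t" "k \<notin> e" and h: "is_hub e (w, g)"
    and A: "finite A" "g k \<in> A" "card A \<le> s" and disj: "hub_set (w, g) \<inter> anchors = {}"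
  shows "\<exists>q. is_leg e k (g k) q \<and> finite (leg_set q) \<and> card (leg_set q) \<le> L \<and> leg_set q \<inter> A = {}"
proof -
  have conn: "(g k, x (insert k e)) \<in> (avoid (F e) {})\<^sup>*"
    using h k by (auto simp: is_hub_def)
  have "x (insert k e) \<in> anchors"
    unfolding anchors_def by (rule flag_of_pair[OF e k]) blast
  moreover have "g k \<in> hub_set (w, g)" using k by (auto simp: hub_set_def)
  ultimately have "g k \<noteq> x (insert k e)" using disj by auto
  then obtain f r where f: "0 < r" "r \<le> L" "f 0 = g k" "f r = x (insert k e)" "inj_on f {..r}"
    "\<And>i. i < r \<Longrightarrow> {f i, f (Suc i)} \<in> F e" "f ` {0<..<r} \<inter> A = {}"
    using robust_path_through[OF F_card[OF e] rob[OF e] A(1,3) conn] by metis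
  have "card (f ` {0<..<r}) \<le> L"
    using card_image_le[of "{0<..<r}" f] f(2) by simp
  then have "is_leg e k (g k) (f, r) \<and> finite (leg_set (f, r)) \<and> card (leg_set (f, r)) \<le> L
      \<and> leg_set (f, r) \<inter> A = {}"
    using f by (simp add: is_leg_def leg_set_def)
  then show ?thesis by blast
qed

text \<open>All hubs are chosen before any leg, so that every leg can avoid all hubs and anchors as
  well as the earlier legs.\<close>

lemma contains_homeomorph_complete3: "contains_homeomorph H (complete3 t)"
proof -
  have "\<exists>h. \<forall>e\<in>pairs t. is_hub e (h e) \<and> finite (hub_set (h e)) \<and> card (hub_set (h e)) \<le> t + 1
      \<and> hub_set (h e) \<inter> anchors = {} \<and> (\<forall>e'\<in>pairs t. e' \<noteq> e \<longrightarrow> hub_set (h e) \<inter> hub_set (h e') = {})"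
  proof (rule greedy_disjoint[OF card_pairs(1) finite_anchors])
    have "card (pairs t) * (t + 1) \<le> t\<^sup>2 * (t + 1)"
      using card_pairs by (intro mult_right_mono) auto
    then show "card anchors + card (pairs t) * (t + 1) \<le> t + t ^ 3 + 1 + t\<^sup>2 * (t + 1)"
      using card_anchors by linarith
  qed (rule hub_exists)
  then obtain h where h0: "\<forall>e\<in>pairs t. is_hub e (h e) \<and> finite (hub_set (h e)) \<and>
      card (hub_set (h e)) \<le> t + 1 \<and> hub_set (h e) \<inter> anchors = {} \<and>
      (\<forall>e'\<in>pairs t. e' \<noteq> e \<longrightarrow> hub_set (h e) \<inter> hub_set (h e') = {})" ..
  have h: "is_hub e (h e)" "finite (hub_set (h e))" "card (hub_set (h e)) \<le> t + 1"
    "hub_set (h e) \<inter> anchors = {}"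
    "e' \<in> pairs t \<Longrightarrow> e' \<noteq> e \<Longrightarrow> hub_set (h e) \<inter> hub_set (h e') = {}" if "e \<in> pairs t" for e e'
    using bspec[OF h0 that] by simp_all
  define w where "w e = fst (h e)" for e
  define g where "g e = snd (h e)" for e
  have hub: "is_hub e (w e, g e)" if "e \<in> pairs t" for e
    using h(1)[OF that] by (simp add: w_def g_def)
  have in_hub: "w e \<in> hub_set (h e)" "k < t \<Longrightarrow> g e k \<in> hub_set (h e)" for e k
    by (auto simp: hub_set_def w_def g_def split: prod.splits)
  define S where "S = anchors \<union> (\<Union>e\<in>pairs t. hub_set (h e))"
  define I where "I = {(e, k). e \<in> pairs t \<and> k < t \<and> k \<notin> e}"
  have S: "finite S" "card S \<le> t + t ^ 3 + 1 + t\<^sup>2 * (t + 1)"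
  proof -
    have "card (\<Union>e\<in>pairs t. hub_set (h e)) \<le> (\<Sum>e\<in>pairs t. card (hub_set (h e)))"
      by (rule card_UN_le[OF card_pairs(1)])
    also have "\<dots> \<le> card (pairs t) * (t + 1)"
      using sum_bounded_above[of "pairs t" "\<lambda>e. card (hub_set (h e))" "t + 1"] h(3) by simp
    also have "\<dots> \<le> t\<^sup>2 * (t + 1)" using card_pairs by (intro mult_right_mono) auto
    finally show "card S \<le> t + t ^ 3 + 1 + t\<^sup>2 * (t + 1)"
      unfolding S_def using card_anchors card_Un_le[of anchors "\<Union>e\<in>pairs t. hub_set (h e)"]
      by linarith
  qed (use h card_pairs finite_anchors in \<open>auto simp: S_def\<close>)
  have I: "finite I" "card I \<le> t ^ 3"
  proof -
    have sub: "I \<subseteq> pairs t \<times> {..<t}" by (auto simp: I_def)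
    then show "finite I" by (rule finite_subset) (simp add: card_pairs)
    have "card I \<le> card (pairs t) * t"
      using card_mono[OF _ sub] card_pairs by (simp add: card_cartesian_product)
    also have "\<dots> \<le> t\<^sup>2 * t" using card_pairs by (intro mult_right_mono) auto
    finally show "card I \<le> t ^ 3" by (simp add: power2_eq_square power3_eq_cube)
  qed
  have "\<exists>q. \<forall>i\<in>I. (case i of (e, k) \<Rightarrow> is_leg e k (g e k)) (q i) \<and> finite (leg_set (q i))
      \<and> card (leg_set (q i)) \<le> L \<and> leg_set (q i) \<inter> S = {}
      \<and> (\<forall>j\<in>I. j \<noteq> i \<longrightarrow> leg_set (q i) \<inter> leg_set (q j) = {})"
  proof (rule greedy_disjoint[OF I(1) S(1)])
    have "card I * L \<le> t ^ 3 * L" using I by simp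
    then show "card S + card I * L \<le> s" using S(2) s by linarith
    fix i A assume i: "i \<in> I" and A: "finite A" "S \<subseteq> A" "card A \<le> s"
    obtain e k where ek: "i = (e, k)" "e \<in> pairs t" "k < t" "k \<notin> e" using i by (auto simp: I_def)
    have "hub_set (h e) \<subseteq> A" using ek(2) A(2) unfolding S_def by blast
    then have "g e k \<in> A" using in_hub(2)[OF ek(3)] by blast
    then show "\<exists>q. (case i of (e, k) \<Rightarrow> is_leg e k (g e k)) q \<and> finite (leg_set q)
        \<and> card (leg_set q) \<le> L \<and> leg_set q \<inter> A = {}"
      using leg_exists[OF ek(2-4) hub[OF ek(2)] A(1) _ A(3)] h(4)[OF ek(2)] ek(1)
      by (simp add: w_def g_def)
  qed
  then obtain q where q0: "\<forall>i\<in>I. (case i of (e, k) \<Rightarrow> is_leg e k (g e k)) (q i) \<and>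
      finite (leg_set (q i)) \<and> card (leg_set (q i)) \<le> L \<and> leg_set (q i) \<inter> S = {}
      \<and> (\<forall>j\<in>I. j \<noteq> i \<longrightarrow> leg_set (q i) \<inter> leg_set (q j) = {})" ..
  have q: "is_leg e k (g e k) (q (e, k))" "leg_set (q (e, k)) \<inter> S = {}"
    "j \<in> I \<Longrightarrow> j \<noteq> (e, k) \<Longrightarrow> leg_set (q (e, k)) \<inter> leg_set (q j) = {}" if "(e, k) \<in> I" for e k j
    using bspec[OF q0 that] by simp_all
  define f where "f e k = fst (q (e, k))" for e k
  define r where "r e k = snd (q (e, k))" for e k
  have leg: "is_leg e k (g e k) (f e k, r e k)" if "(e, k) \<in> I" for e k
    using q(1)[OF that] by (simp add: f_def r_def)
  have leg_set_eq: "leg_set (q (e, k)) = f e k ` {0<..<r e k}" for e k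
    by (simp add: leg_set_def f_def r_def split: prod.splits)
  \<comment> \<open>Position 0 is the centre and the path \<open>f\<close> is shifted by one, whence
    the length is \<open>Suc (r e k)\<close>.\<close>
  define P where "P e k n = (case n of 0 \<Rightarrow> w e | Suc n \<Rightarrow> f e k n)" for e k n
  define len where "len e k = Suc (r e k)" for e k
  have flag_I: "({i, j}, k) \<in> I" if "flag t i j k" for i j k
    using that by (auto simp: flag_def I_def pairs_def)
  have flag_pairs: "{i, j} \<in> pairs t" if "flag t i j k" for i j k
    using that by (auto simp: flag_def pairs_def)
  have P_cases: "n = 0 \<and> P e k n = w e \<or> n = 1 \<and> P e k n = g e k \<or>
      (\<exists>m\<in>{0<..<r e k}. n = Suc m \<and> P e k n = f e k m) \<or> n = len e k \<and> P e k n = x (insert k e)"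
    if "(e, k) \<in> I" "n \<le> len e k" for e k n
  proof (cases n)
    case (Suc m)
    then have "m \<le> r e k" using that(2) by (simp add: len_def)
    then consider "m = 0" | "0 < m" "m < r e k" | "m = r e k" by linarith
    then show ?thesis
      using leg[OF that(1)] Suc by cases (auto simp: P_def len_def is_leg_def)
  qed (simp add: P_def)
  have sep: "w e \<in> hub_set (h e)" "g e k \<in> hub_set (h e)" "w e \<noteq> g e k"
    "x (insert k e) \<in> anchors" "insert k e \<in> triples t" if "(e, k) \<in> I" for e k
  proof -
    have ek: "e \<in> pairs t" "k < t" "k \<notin> e" using that by (auto simp: I_def)
    show "w e \<in> hub_set (h e)" "g e k \<in> hub_set (h e)" using in_hub ek by auto
    have "{w e, g e k} \<in> F e" using hub[OF ek(1)] ek by (simp add: is_hub_def)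
    then show "w e \<noteq> g e k" using F_card[OF ek(1)] by fastforce
    show tr: "insert k e \<in> triples t" using flag_of_pair[OF ek] by blast
    then show "x (insert k e) \<in> anchors" by (auto simp: anchors_def)
  qed
  have interior: "f e k m \<in> leg_set (q (e, k))" if "m \<in> {0<..<r e k}" for e k m
    using that leg_set_eq by auto
  interpret spiders t v P len
  proof
    show "inj_on v {..<t}" by (rule inj_v)
    show "0 < len {i, j} k" for i j k by (simp add: len_def)
    show "P {i, j} k 0 = P {i, j} k' 0" for i j k k' by (simp add: P_def)
    show "v l \<noteq> P {i, j} k n" if fl: "flag t i j k" and n: "n \<le> len {i, j} k" and l: "l < t" for i j k n l
    proof -
      have ek: "({i, j}, k) \<in> I" by (rule flag_I[OF fl])
      have e: "{i, j} \<in> pairs t" by (rule flag_pairs[OF fl])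
      have "v l \<in> anchors" using l by (auto simp: anchors_def)
      moreover from this have "v l \<in> S" by (simp add: S_def)
      moreover have "x (insert k {i, j}) \<noteq> v l" using x_v[OF sep(5)[OF ek] l] .
      ultimately show ?thesis
        using P_cases[OF ek n] sep(1,2)[OF ek] h(4)[OF e] q(2)[OF ek] interior
        by (metis disjoint_iff)
    qed
    show "P {i, j} k (len {i, j} k) = P {i', j'} k' (len {i', j'} k')"
      if fl: "flag t i j k" "flag t i' j' k'" and eq: "{i, j, k} = {i', j', k'}" for i j k i' j' k'
    proof -
      have "insert k {i, j} = insert k' {i', j'}" using eq by (metis insert_commute)
      then show ?thesis
        using leg[OF flag_I[OF fl(1)]] leg[OF flag_I[OF fl(2)]] by (simp add: P_def len_def is_leg_def)
    qed
    show "{i, j} = {i', j'} \<and> k = k' \<and> n = n' \<or> {i, j} = {i', j'} \<and> n = 0 \<and> n' = 0 \<or>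
        n = len {i, j} k \<and> n' = len {i', j'} k' \<and> {i, j, k} = {i', j', k'}"
      if fl: "flag t i j k" "flag t i' j' k'" and n: "n \<le> len {i, j} k" "n' \<le> len {i', j'} k'"
        and eq: "P {i, j} k n = P {i', j'} k' n'" for i j k i' j' k' n n'
    proof -
      define e where "e = {i, j}"
      define e' where "e' = {i', j'}"
      have I: "(e, k) \<in> I" "(e', k') \<in> I" using fl flag_I by (auto simp: e_def e'_def)
      then have e: "e \<in> pairs t" "e' \<in> pairs t" "k < t" "k' < t" by (auto simp: I_def)
      have SA: "hub_set (h e) \<subseteq> S" "hub_set (h e') \<subseteq> S" "anchors \<subseteq> S"
        using e by (auto simp: S_def)
      note n = n[folded e_def e'_def] and eq = eq[folded e_def e'_def]
      note facts = sep[OF I(1)] sep[OF I(2)] h(4)[OF e(1)] h(4)[OF e(2)] q(2)[OF I(1)] q(2)[OF I(2)] SA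
      have inS: "w e \<in> S" "g e k \<in> S" "x (insert k e) \<in> S"
          "w e' \<in> S" "g e' k' \<in> S" "x (insert k' e') \<in> S"
        using facts by blast+
      have nS: "m \<in> {0<..<r e k} \<Longrightarrow> f e k m \<notin> S" "m \<in> {0<..<r e' k'} \<Longrightarrow> f e' k' m \<notin> S" for m
        using interior q(2)[OF I(1)] q(2)[OF I(2)] by blast+
      have nA: "w e \<noteq> x (insert k' e')" "g e k \<noteq> x (insert k' e')"
          "w e' \<noteq> x (insert k e)" "g e' k' \<noteq> x (insert k e)"
        using sep(1,2,4)[OF I(1)] sep(1,2,4)[OF I(2)] h(4)[OF e(1)] h(4)[OF e(2)]
        by (metis disjoint_iff)+
      have hub_eq: "e = e'" if "u \<in> hub_set (h e)" "u \<in> hub_set (h e')" for u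
        using h(5)[OF e(1,2)] that by blast
      have swap: "{i, j, k} = insert k e" "{i', j', k'} = insert k' e'"
        by (auto simp: e_def e'_def)
      \<comment> \<open>Centres and first vertices lie in hubs, feet among the anchors, and interior
        vertices of legs outside both. Coincidences can therefore occur only within one of these
        three classes.\<close>
      have "e = e' \<and> k = k' \<and> n = n' \<or> e = e' \<and> n = 0 \<and> n' = 0 \<or>
        n = len e k \<and> n' = len e' k' \<and> insert k e = insert k' e'"
        using P_cases[OF I(1) n(1)]
      proof (elim disjE bexE conjE)
        assume 1: "n = 0" "P e k n = w e"
        show ?thesis
          using P_cases[OF I(2) n(2)]
        proof (elim disjE bexE conjE)
          assume 2: "n' = 0" "P e' k' n' = w e'"
          have "e = e'" using hub_eq[of "w e"] facts(1,6) 1 2 eq by simp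
          then show ?thesis using 1 2 by simp
        next
          assume 2: "n' = 1" "P e' k' n' = g e' k'"
          have "e = e'" using hub_eq[of "w e"] facts(1,7) 1 2 eq by simp
          then show ?thesis using facts(8) 1 2 eq by simp
        next
          fix m assume 2: "m \<in> {0<..<r e' k'}" "P e' k' n' = f e' k' m"
          then show ?thesis using nS(2)[OF 2(1)] inS(1) 1 eq by simp
        next
          assume "P e' k' n' = x (insert k' e')"
          then show ?thesis using nA(1) 1 eq by simp
        qed
      next
        assume 1: "n = 1" "P e k n = g e k"
        show ?thesis
          using P_cases[OF I(2) n(2)]
        proof (elim disjE bexE conjE)
          assume 2: "n' = 0" "P e' k' n' = w e'"
          have "e = e'" using hub_eq[of "w e'"] facts(2,6) 1 2 eq by simp
          then show ?thesis using facts(3) 1 2 eq by simp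
        next
          assume 2: "n' = 1" "P e' k' n' = g e' k'"
          have ee: "e = e'" using hub_eq[of "g e k"] facts(2,7) 1 2 eq by simp
          have "inj_on (g e) {..<t}" using hub[OF e(1)] by (simp add: is_hub_def)
          then have "k = k'" using ee 1 2 eq e by (simp add: inj_on_def)
          then show ?thesis using ee 1 2 by simp
        next
          fix m assume 2: "m \<in> {0<..<r e' k'}" "P e' k' n' = f e' k' m"
          then show ?thesis using nS(2)[OF 2(1)] inS(2) 1 eq by simp
        next
          assume "P e' k' n' = x (insert k' e')"
          then show ?thesis using nA(2) 1 eq by simp
        qed
      next
        fix m assume 1: "m \<in> {0<..<r e k}" "n = Suc m" "P e k n = f e k m"
        note fS = interior[OF 1(1)] nS(1)[OF 1(1)]
        show ?thesis
          using P_cases[OF I(2) n(2)]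
        proof (elim disjE bexE conjE)
          fix m' assume 2: "m' \<in> {0<..<r e' k'}" "n' = Suc m'" "P e' k' n' = f e' k' m'"
          have "f e k m \<in> leg_set (q (e', k'))" using interior[OF 2(1)] 1 2 eq by simp
          then have ek: "(e, k) = (e', k')" using fS q(3)[OF I] by blast
          have "inj_on (f e k) {..r e k}" using leg[OF I(1)] by (simp add: is_leg_def)
          then have "m = m'" using ek 1 2 eq by (auto dest: inj_onD)
          then show ?thesis using ek 1 2 by simp
        qed (use inS(4-6) 1 eq fS(2) in simp_all)
      next
        assume 1: "n = len e k" "P e k n = x (insert k e)"
        show ?thesis
          using P_cases[OF I(2) n(2)]
        proof (elim disjE bexE conjE)
          fix m assume 2: "m \<in> {0<..<r e' k'}" "P e' k' n' = f e' k' m"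
          then show ?thesis using nS(2)[OF 2(1)] inS(3) 1 eq by simp
        next
          assume 2: "n' = len e' k'" "P e' k' n' = x (insert k' e')"
          have "insert k e = insert k' e'"
            using inj_onD[OF inj_x _ facts(5,10)] 1 2 eq by simp
          then show ?thesis using 1 2 by blast
        qed (use nA(3,4) 1 eq in simp_all)
      qed
      then show ?thesis unfolding e_def[symmetric] e'_def[symmetric] swap .
    qed
  qed
  have "fans \<subseteq> H"
  proof
    fix p assume "p \<in> fans"
    then obtain i j k n where p: "p = {v i, P {i, j} k n, P {i, j} k (Suc n)}"
      and fl: "flag t i j k" and n: "n < len {i, j} k"
      unfolding fans_def by blast
    have "{P {i, j} k n, P {i, j} k (Suc n)} \<in> F {i, j}"
    proof (cases n)
      case 0
      have "f {i, j} k 0 = g {i, j} k" using leg[OF flag_I[OF fl]] by (simp add: is_leg_def)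
      moreover have "{w {i, j}, g {i, j} k} \<in> F {i, j}"
        using hub[OF flag_pairs[OF fl]] fl by (auto simp: is_hub_def flag_def)
      ultimately show ?thesis using 0 by (simp add: P_def)
    next
      case (Suc m)
      then show ?thesis using leg[OF flag_I[OF fl]] n by (simp add: is_leg_def P_def len_def)
    qed
    then show "p \<in> H" using F_link[of i j] fl p by (simp add: flag_def)
  qed
  then show ?thesis
    unfolding contains_homeomorph_def using fans_homeomorphic_complete3 by blast
qed

end

section \<open>Dependent random choice\<close>

text \<open>A union bound over all maps into \<open>Z\<close>: each of the at most
  \<open>t ^ 3\<close> flags is mapped into \<open>B\<close> by at most
  \<open>card B * card Z ^ (t - 3)\<close> maps, out of \<open>card Z ^ t\<close>.\<close>

lemma avoid_bad_triples:
  assumes Z: "finite Z" and B: "B \<subseteq> Z \<times> Z \<times> Z" and t: "3 \<le> t"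
    and small: "card B * t ^ 3 < card Z ^ 3"
  obtains f where "f \<in> {..<t} \<rightarrow> Z" "\<And>i j k. flag t i j k \<Longrightarrow> (f i, f j, f k) \<notin> B"
proof -
  let ?d = "card Z" and ?I = "{..<t} \<times> {..<t} \<times> {..<t}"
  let ?bad = "\<lambda>(i, j, k). {f \<in> {..<t} \<rightarrow>\<^sub>E Z. flag t i j k \<and> (f i, f j, f k) \<in> B}"
  have finB: "finite B" using B Z finite_subset by blast
  have fin: "finite ({..<t} \<rightarrow>\<^sub>E Z)" using Z by (intro finite_PiE) auto
  have one: "card (?bad p) \<le> card B * ?d ^ (t - 3)" for p
  proof (cases p)
    case (fields i j k)
    show ?thesis
    proof (cases "flag t i j k")
      case True
      let ?J = "{..<t} - {i, j, k}"
      have cJ: "card ?J = t - 3"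
        using True by (subst card_Diff_subset) (auto simp: flag_def)
      \<comment> \<open>A map is determined by its values at \<open>i\<close>, \<open>j\<close>,
        \<open>k\<close> and its restriction to the remaining indices.\<close>
      have "inj_on (\<lambda>f. ((f i, f j, f k), restrict f ?J)) (?bad p)"
      proof (rule inj_onI)
        fix f g
        assume f: "f \<in> ?bad p" and g: "g \<in> ?bad p"
          and eq: "((f i, f j, f k), restrict f ?J) = ((g i, g j, g k), restrict g ?J)"
        have "f l = g l" if "l < t" for l
        proof (cases "l \<in> ?J")
          case True
          have "restrict f ?J l = restrict g ?J l" using eq by simp
          then show ?thesis using True by simp
        qed (use eq that in auto)
        then show "f = g"
          using f g fields by (intro PiE_ext[of f "{..<t}" "\<lambda>_. Z" g]) auto
      qed
      moreover have "(\<lambda>f. ((f i, f j, f k), restrict f ?J)) ` ?bad p \<subseteq> B \<times> (?J \<rightarrow>\<^sub>E Z)"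
      proof (rule image_subsetI)
        fix f assume "f \<in> ?bad p"
        then have f: "f \<in> {..<t} \<rightarrow>\<^sub>E Z" "(f i, f j, f k) \<in> B" using fields by simp_all
        then have "restrict f ?J \<in> ?J \<rightarrow>\<^sub>E Z"
          unfolding restrict_PiE_iff by (blast intro: PiE_mem)
        then show "((f i, f j, f k), restrict f ?J) \<in> B \<times> (?J \<rightarrow>\<^sub>E Z)" using f(2) by blast
      qed
      moreover have "finite (B \<times> (?J \<rightarrow>\<^sub>E Z))"
        using finB Z by (intro finite_cartesian_product finite_PiE) auto
      ultimately have "card (?bad p) \<le> card (B \<times> (?J \<rightarrow>\<^sub>E Z))"
        by (rule card_inj_on_le)
      also have "\<dots> = card B * ?d ^ (t - 3)"
        unfolding card_cartesian_product using cJ by (subst card_funcsetE) auto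
      finally show ?thesis .
    qed (use fields in simp)
  qed
  have dpos: "0 < ?d" using small by (cases "?d") auto
  have "card (\<Union>p\<in>?I. ?bad p) \<le> (\<Sum>p\<in>?I. card (?bad p))" by (rule card_UN_le) auto
  also have "\<dots> \<le> card ?I * (card B * ?d ^ (t - 3))"
    using sum_bounded_above[of ?I "\<lambda>p. card (?bad p)" "card B * ?d ^ (t - 3)"] one by simp
  also have "\<dots> = (card B * t ^ 3) * ?d ^ (t - 3)"
    by (simp add: power3_eq_cube)
  also have "\<dots> < ?d ^ 3 * ?d ^ (t - 3)"
    using small dpos by simp
  also have "\<dots> = card ({..<t} \<rightarrow>\<^sub>E Z)"
    using t by (simp add: card_funcsetE power_add[symmetric])
  finally have less: "card (\<Union>p\<in>?I. ?bad p) < card ({..<t} \<rightarrow>\<^sub>E Z)" .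
  have "(\<Union>p\<in>?I. ?bad p) \<subseteq> {..<t} \<rightarrow>\<^sub>E Z" by auto
  then have "finite (\<Union>p\<in>?I. ?bad p)" using fin by (rule finite_subset)
  then have "\<not> ({..<t} \<rightarrow>\<^sub>E Z) \<subseteq> (\<Union>p\<in>?I. ?bad p)"
    using less card_mono by (meson leD)
  then obtain f where f: "f \<in> {..<t} \<rightarrow>\<^sub>E Z" "f \<notin> (\<Union>p\<in>?I. ?bad p)" by blast
  have "(f i, f j, f k) \<notin> B" if fl: "flag t i j k" for i j k
  proof
    assume "(f i, f j, f k) \<in> B"
    then have "f \<in> ?bad (i, j, k)" "(i, j, k) \<in> ?I" using f fl by (auto simp: flag_def)
    then show False using f(2) by blast
  qed
  then show thesis using that[of f] f(1) by (auto simp: PiE_iff)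
qed

lemma card_ordered_edges:
  assumes E: "graph_on V E"
  shows "card {w \<in> V \<times> V. {fst w, snd w} \<in> E} = 2 * card E"
proof -
  have finV: "finite V" using E by (simp add: graph_on_def)
  have sub: "nbrs E u \<subseteq> V" for u using E by (auto simp: nbrs_def graph_on_def)
  have "{w \<in> V \<times> V. {fst w, snd w} \<in> E} = (SIGMA u:V. nbrs E u)"
    using sub by (auto simp: nbrs_def)
  then have "card {w \<in> V \<times> V. {fst w, snd w} \<in> E} = (\<Sum>u\<in>V. card (nbrs E u))"
    using finV finite_subset[OF sub] by simp
  also have "\<dots> = vol E V"
    unfolding vol_def using E by (intro sum.cong refl card_nbrs) (auto simp: graph_on_def)
  finally show ?thesis using vol_all[OF E] by simp
qed

text \<open>If \<open>d > 9 * \<tau>\<close> and \<open>d\<^sup>2 > 9 * \<tau> * P\<close>, the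
  first two terms on the right are each below a third of \<open>d ^ 3\<close>, which leaves
  \<open>d ^ 3 \<le> 3 * \<tau> * T\<close>. The free threshold \<open>u\<^sup>2\<close> for
  \<open>d\<close> turns this into a bound on \<open>d\<^sup>2\<close>.\<close>

lemma square_le_of_cube_le:
  fixes d P T u \<tau> :: real
  assumes "0 \<le> d" "0 \<le> P" "0 \<le> T" "1 \<le> u" "0 \<le> \<tau>" and le: "d ^ 3 \<le> \<tau> * (3 * d\<^sup>2 + 3 * P * d + T)"
  shows "d\<^sup>2 \<le> 81 * \<tau>\<^sup>2 + 9 * \<tau> * P + u ^ 4 + 3 * \<tau> * T / u\<^sup>2"
proof -
  have nn: "0 \<le> 81 * \<tau>\<^sup>2" "0 \<le> 9 * \<tau> * P" "0 \<le> u ^ 4" "0 \<le> 3 * \<tau> * T / u\<^sup>2"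
    using assms by auto
  consider "d \<le> 9 * \<tau>" | "d\<^sup>2 \<le> 9 * \<tau> * P" | "9 * \<tau> < d" "9 * \<tau> * P < d\<^sup>2" by linarith
  then show ?thesis
  proof cases
    case 1
    then have "d\<^sup>2 \<le> (9 * \<tau>)\<^sup>2" using assms by (intro power_mono) auto
    then have "d\<^sup>2 \<le> 81 * \<tau>\<^sup>2" by (simp add: power_mult_distrib)
    then show ?thesis using nn by linarith
  next
    case 2
    then show ?thesis using nn by linarith
  next
    case 3
    have d: "0 < d" using 3 assms by linarith
    have "9 * \<tau> * d\<^sup>2 < d * d\<^sup>2" using 3(1) d by (intro mult_strict_right_mono) auto
    moreover have "9 * \<tau> * P * d < d\<^sup>2 * d" using 3(2) d by (intro mult_strict_right_mono) auto
    ultimately have cube: "d ^ 3 \<le> 3 * \<tau> * T"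
      using le by (simp add: power3_eq_cube power2_eq_square algebra_simps)
    show ?thesis
    proof (cases "d \<le> u\<^sup>2")
      case True
      then have "d\<^sup>2 \<le> (u\<^sup>2)\<^sup>2" using d by (intro power_mono) auto
      then have "d\<^sup>2 \<le> u ^ 4" by simp
      then show ?thesis using nn by linarith
    next
      case False
      then have "d\<^sup>2 * u\<^sup>2 \<le> d\<^sup>2 * d" using d by (intro mult_left_mono) auto
      also have "\<dots> \<le> 3 * \<tau> * T" using cube by (simp add: power3_eq_cube power2_eq_square)
      finally have "d\<^sup>2 \<le> 3 * \<tau> * T / u\<^sup>2" using assms by (simp add: field_simps)
      then show ?thesis using nn by linarith
    qed
  qed
qed

section \<open>Double counting of bad triples\<close>

definition link_graph :: "nat set \<Rightarrow> nat set set \<Rightarrow> nat set \<Rightarrow> nat set set" where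
  "link_graph V H S = {p. p \<subseteq> V \<and> card p = 2 \<and> (\<forall>c\<in>S. insert c p \<in> H)}"

lemma graph_on_link: "finite V \<Longrightarrow> graph_on V (link_graph V H S)"
  by (auto simp: graph_on_def link_graph_def)

locale link_subgraphs =
  fixes V :: "nat set" and H :: "nat set set" and F :: "nat set \<Rightarrow> nat set set" and m :: nat
  assumes uniform: "uniform3_on V H" and F_sub: "F S \<subseteq> link_graph V H S"
begin

abbreviation n :: nat where "n \<equiv> card V"

definition apexes :: "nat \<times> nat \<Rightarrow> nat set" where
  "apexes w = {z \<in> V. {fst w, snd w, z} \<in> H}"

text \<open>By \<open>apexes_iff\<close> the edge given by \<open>w\<close> belongs to the common
  link of such a pair, so it was lost in passing to \<open>F\<close>.\<close>

definition unlinked :: "nat \<times> nat \<Rightarrow> (nat \<times> nat) set" where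
  "unlinked w = {p \<in> V \<times> V. fst p \<in> apexes w \<and> snd p \<in> apexes w \<and> {fst w, snd w} \<notin> F {fst p, snd p}}"

definition common :: "nat \<times> nat \<times> nat \<Rightarrow> nat set set" where
  "common = (\<lambda>(a, b, c). F {a, b} \<inter> F {b, c} \<inter> F {a, c})"

text \<open>The second component of \<open>w\<close> stays fixed while the first one varies, because
  all feet must be adjacent to the same vertex \<open>y\<close>.\<close>

definition poor :: "nat \<times> nat \<Rightarrow> (nat \<times> nat \<times> nat) set" where
  "poor w = {q \<in> V \<times> V \<times> V. {fst w, snd w} \<in> common q \<and> card {x \<in> V. {x, snd w} \<in> common q} < m}"

definition bad :: "nat \<times> nat \<Rightarrow> (nat \<times> nat \<times> nat) set" where
  "bad w = {(a, b, c) \<in> apexes w \<times> apexes w \<times> apexes w. a = b \<or> b = c \<or> a = c \<or>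
     {fst w, snd w} \<notin> common (a, b, c) \<or> card {x \<in> V. {x, snd w} \<in> common (a, b, c)} < m}"

lemma finV: "finite V"
  using uniform by (simp add: uniform3_on_def)

lemma finite_apexes: "finite (apexes w)"
  using finV by (simp add: apexes_def)

lemma edge_distinct: "{x, y, z} \<in> H \<Longrightarrow> x \<noteq> y \<and> x \<noteq> z \<and> y \<noteq> z"
  using uniform by (auto simp: uniform3_on_def card_insert_if split: if_splits)

text \<open>A bad triple repeats a vertex, or contains an unlinked pair in one of three positions,
  or is poor.\<close>

lemma card_bad:
  "card (bad w) \<le> 3 * (card (apexes w))\<^sup>2 + 3 * card (unlinked w) * card (apexes w) + card (poor w)"
proof -
  let ?Z = "apexes w" and ?U = "unlinked w"
  let ?A1 = "(\<lambda>(a, c). (a, a, c)) ` (?Z \<times> ?Z)" and ?A2 = "(\<lambda>(a, c). (a, c, c)) ` (?Z \<times> ?Z)"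
    and ?A3 = "(\<lambda>(a, c). (a, c, a)) ` (?Z \<times> ?Z)"
  let ?B1 = "(\<lambda>((a, b), c). (a, b, c)) ` (?U \<times> ?Z)" and ?B2 = "(\<lambda>((b, c), a). (a, b, c)) ` (?U \<times> ?Z)"
    and ?B3 = "(\<lambda>((a, c), b). (a, b, c)) ` (?U \<times> ?Z)"
  have finU: "finite ?U" using finV by (simp add: unlinked_def)
  have sub: "bad w \<subseteq> ?A1 \<union> (?A2 \<union> (?A3 \<union> (?B1 \<union> (?B2 \<union> (?B3 \<union> poor w)))))"
  proof
    fix q assume q: "q \<in> bad w"
    obtain a b c where abc: "q = (a, b, c)" by (metis prod_cases3)
    have Z: "a \<in> ?Z" "b \<in> ?Z" "c \<in> ?Z" "a \<in> V" "b \<in> V" "c \<in> V"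
      using q abc by (auto simp: bad_def apexes_def)
    have U: "(a', b') \<in> ?U" if "{fst w, snd w} \<notin> F {a', b'}" "a' \<in> ?Z" "b' \<in> ?Z" for a' b'
      using that by (auto simp: unlinked_def apexes_def)
    consider "a = b" | "b = c" | "a = c" | "(a, b) \<in> ?U" | "(b, c) \<in> ?U" | "(a, c) \<in> ?U" | "q \<in> poor w"
    proof -
      assume *: "a = b \<Longrightarrow> thesis" "b = c \<Longrightarrow> thesis" "a = c \<Longrightarrow> thesis" "(a, b) \<in> ?U \<Longrightarrow> thesis"
        "(b, c) \<in> ?U \<Longrightarrow> thesis" "(a, c) \<in> ?U \<Longrightarrow> thesis" "q \<in> poor w \<Longrightarrow> thesis"
      show thesis
        using q U[OF _ Z(1,2)] U[OF _ Z(2,3)] U[OF _ Z(1,3)] Z(4-6) *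
        unfolding bad_def poor_def abc common_def by auto
    qed
    then show "q \<in> ?A1 \<union> (?A2 \<union> (?A3 \<union> (?B1 \<union> (?B2 \<union> (?B3 \<union> poor w)))))"
    proof cases
      case 1
      then have "q \<in> ?A1" using Z abc by (intro image_eqI[of _ _ "(a, c)"]) auto
      then show ?thesis by blast
    next
      case 2
      then have "q \<in> ?A2" using Z abc by (intro image_eqI[of _ _ "(a, c)"]) auto
      then show ?thesis by blast
    next
      case 3
      then have "q \<in> ?A3" using Z abc by (intro image_eqI[of _ _ "(a, b)"]) auto
      then show ?thesis by blast
    next
      case 4
      then have "q \<in> ?B1" using Z abc by (intro image_eqI[of _ _ "((a, b), c)"]) auto
      then show ?thesis by blast
    next
      case 5
      then have "q \<in> ?B2" using Z abc by (intro image_eqI[of _ _ "((b, c), a)"]) auto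
      then show ?thesis by blast
    next
      case 6
      then have "q \<in> ?B3" using Z abc by (intro image_eqI[of _ _ "((a, c), b)"]) auto
      then show ?thesis by blast
    next
      case 7
      then show ?thesis by blast
    qed
  qed
  have fin: "finite (poor w)" using finV by (simp add: poor_def)
  have "card (bad w) \<le> card (?A1 \<union> (?A2 \<union> (?A3 \<union> (?B1 \<union> (?B2 \<union> (?B3 \<union> poor w))))))"
    by (rule card_mono[OF _ sub]) (use finU fin finite_apexes in auto)
  also have "\<dots> \<le> card ?A1 + (card ?A2 + (card ?A3 + (card ?B1 + (card ?B2 + (card ?B3 + card (poor w))))))"
    by (intro order_trans[OF card_Un_le] add_left_mono) simp
  also have "\<dots> \<le> card (?Z \<times> ?Z) + (card (?Z \<times> ?Z) + (card (?Z \<times> ?Z) + (card (?U \<times> ?Z)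
      + (card (?U \<times> ?Z) + (card (?U \<times> ?Z) + card (poor w))))))"
    by (intro add_mono card_image_le order_refl) (use finU finite_apexes in auto)
  finally show ?thesis by (simp add: card_cartesian_product power2_eq_square)
qed

text \<open>This exchange of roles between \<open>w\<close> and the pair \<open>a\<close>,
  \<open>b\<close> drives the double counting below.\<close>

lemma apexes_iff:
  assumes "w \<in> V \<times> V" "a \<in> V" "b \<in> V"
  shows "a \<in> apexes w \<and> b \<in> apexes w \<longleftrightarrow> {fst w, snd w} \<in> link_graph V H {a, b}"
  using assms edge_distinct[of "fst w" "snd w" a]
  by (auto simp: apexes_def link_graph_def insert_commute card_insert_if)

text \<open>Both sides count pairs of \<open>w\<close> and an ordered pair of its apexes; the factor
  2 stems from the two orderings of a link edge.\<close>

lemma sum_apexes_squared: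
  "(\<Sum>w\<in>V \<times> V. (card (apexes w))\<^sup>2) = (\<Sum>p\<in>V \<times> V. 2 * card (link_graph V H {fst p, snd p}))"
proof -
  have "(\<Sum>w\<in>V \<times> V. (card (apexes w))\<^sup>2)
      = (\<Sum>w\<in>V \<times> V. card {p \<in> V \<times> V. fst p \<in> apexes w \<and> snd p \<in> apexes w})"
  proof (rule sum.cong)
    fix w
    have "{p \<in> V \<times> V. fst p \<in> apexes w \<and> snd p \<in> apexes w} = apexes w \<times> apexes w"
      by (auto simp: apexes_def)
    then show "(card (apexes w))\<^sup>2 = card {p \<in> V \<times> V. fst p \<in> apexes w \<and> snd p \<in> apexes w}"
      by (simp add: card_cartesian_product power2_eq_square)
  qed simp
  also have "\<dots> = (\<Sum>p\<in>V \<times> V. 2 * card (link_graph V H {fst p, snd p}))"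
  proof (rule sum_multicount_gen)
    show "\<forall>p\<in>V \<times> V. card {w \<in> V \<times> V. fst p \<in> apexes w \<and> snd p \<in> apexes w}
        = 2 * card (link_graph V H {fst p, snd p})"
    proof
      fix p assume p: "p \<in> V \<times> V"
      have "fst p \<in> apexes w \<and> snd p \<in> apexes w \<longleftrightarrow>
          {fst w, snd w} \<in> link_graph V H {fst p, snd p}" if "w \<in> V \<times> V" for w
        using p by (intro apexes_iff that) auto
      then have "{w \<in> V \<times> V. fst p \<in> apexes w \<and> snd p \<in> apexes w}
          = {w \<in> V \<times> V. {fst w, snd w} \<in> link_graph V H {fst p, snd p}}"
        by blast
      then show "card {w \<in> V \<times> V. fst p \<in> apexes w \<and> snd p \<in> apexes w}
          = 2 * card (link_graph V H {fst p, snd p})"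
        using card_ordered_edges[OF graph_on_link[OF finV]] by simp
    qed
  qed (use finV in auto)
  finally show ?thesis .
qed

lemma sum_unlinked:
  "(\<Sum>w\<in>V \<times> V. card (unlinked w))
     = (\<Sum>p\<in>V \<times> V. 2 * card (link_graph V H {fst p, snd p} - F {fst p, snd p}))"
  unfolding unlinked_def
proof (rule sum_multicount_gen)
  show "\<forall>p\<in>V \<times> V. card {w \<in> V \<times> V. fst p \<in> apexes w \<and> snd p \<in> apexes w
        \<and> {fst w, snd w} \<notin> F {fst p, snd p}}
      = 2 * card (link_graph V H {fst p, snd p} - F {fst p, snd p})"
  proof
    fix p assume p: "p \<in> V \<times> V"
    let ?E = "link_graph V H {fst p, snd p} - F {fst p, snd p}"
    have "fst p \<in> apexes w \<and> snd p \<in> apexes w \<longleftrightarrow>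
        {fst w, snd w} \<in> link_graph V H {fst p, snd p}" if "w \<in> V \<times> V" for w
      using p by (intro apexes_iff that) auto
    then have "{w \<in> V \<times> V. fst p \<in> apexes w \<and> snd p \<in> apexes w \<and> {fst w, snd w} \<notin> F {fst p, snd p}}
        = {w \<in> V \<times> V. {fst w, snd w} \<in> ?E}"
      by blast
    moreover have "graph_on V ?E"
      using graph_on_subset[OF graph_on_link[OF finV]] by blast
    ultimately show "card {w \<in> V \<times> V. fst p \<in> apexes w \<and> snd p \<in> apexes w
        \<and> {fst w, snd w} \<notin> F {fst p, snd p}} = 2 * card ?E"
      using card_ordered_edges[of V ?E] by argo
  qed
qed (use finV in auto)

text \<open>For each of the \<open>n ^ 3\<close> triples and each second component, the first
  components contribute only if there are fewer than \<open>m\<close> of them.\<close>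

lemma sum_poor: "(\<Sum>w\<in>V \<times> V. card (poor w)) \<le> n ^ 4 * m"
proof -
  have "(\<Sum>w\<in>V \<times> V. card (poor w)) = (\<Sum>q\<in>V \<times> V \<times> V. card {w \<in> V \<times> V. {fst w, snd w} \<in> common q
      \<and> card {x \<in> V. {x, snd w} \<in> common q} < m})"
    unfolding poor_def by (rule sum_multicount_gen) (use finV in auto)
  also have "\<dots> \<le> card (V \<times> V \<times> V) * (n * m)"
  proof -
    have "card {w \<in> V \<times> V. {fst w, snd w} \<in> common q \<and> card {x \<in> V. {x, snd w} \<in> common q} < m} \<le> n * m" for q
    proof -
      let ?X = "\<lambda>y. {x \<in> V. {x, y} \<in> common q \<and> card {x \<in> V. {x, y} \<in> common q} < m}"
      have "{w \<in> V \<times> V. {fst w, snd w} \<in> common q \<and> card {x \<in> V. {x, snd w} \<in> common q} < m}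
          = prod.swap ` (SIGMA y:V. ?X y)" by force
      then have "card {w \<in> V \<times> V. {fst w, snd w} \<in> common q \<and> card {x \<in> V. {x, snd w} \<in> common q} < m}
          \<le> card (SIGMA y:V. ?X y)"
        by (simp only:) (rule card_image_le, use finV in auto)
      also have "\<dots> = (\<Sum>y\<in>V. card (?X y))" using finV by (intro card_SigmaI) auto
      also have "\<dots> \<le> (\<Sum>y\<in>V. m)"
      proof (rule sum_mono)
        fix y assume "y \<in> V"
        show "card (?X y) \<le> m"
          by (cases "card {x \<in> V. {x, y} \<in> common q} < m") auto
      qed
      finally show ?thesis by simp
    qed
    then show ?thesis
      using sum_bounded_above[of "V \<times> V \<times> V"] by (metis (no_types, lifting) of_nat_id)
  qed
  also have "\<dots> = n ^ 4 * m"
    by (simp add: card_cartesian_product power4_eq_xxxx algebra_simps)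
  finally show ?thesis .
qed

lemma card_le_sum_apexes: "card H \<le> (\<Sum>w\<in>V \<times> V. card (apexes w))"
proof -
  have "H \<subseteq> (\<lambda>(w, z). {fst w, snd w, z}) ` (SIGMA w:V \<times> V. apexes w)"
  proof
    fix e assume e: "e \<in> H"
    then have "card e = 3" "e \<subseteq> V" using uniform by (auto simp: uniform3_on_def)
    then obtain x y z where "e = {x, y, z}" "x \<in> V" "y \<in> V" "z \<in> V" by (auto simp: card_3_iff)
    then have "e = (\<lambda>(w, z). {fst w, snd w, z}) ((x, y), z)" "((x, y), z) \<in> (SIGMA w:V \<times> V. apexes w)"
      using e by (auto simp: apexes_def)
    then show "e \<in> (\<lambda>(w, z). {fst w, snd w, z}) ` (SIGMA w:V \<times> V. apexes w)" by (rule image_eqI)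
  qed
  moreover have fin: "finite (SIGMA w:V \<times> V. apexes w)"
    using finV finite_apexes by auto
  ultimately have "card H \<le> card (SIGMA w:V \<times> V. apexes w)"
    by (meson card_image_le card_mono finite_imageI le_trans)
  also have "\<dots> = (\<Sum>w\<in>V \<times> V. card (apexes w))"
    using finV finite_apexes by (intro card_SigmaI) auto
  finally show ?thesis .
qed

text \<open>Otherwise every ordered pair \<open>w\<close> with \<open>d = card (apexes w)\<close> has many bad triples.  Summing
  the resulting bounds on \<open>d\<^sup>2\<close>, the unlinked pairs contribute at most half of the total by
  \<open>budget\<close>, and the rest is of order \<open>n powr (10 / 3)\<close>, whereas Cauchy-Schwarz bounds the total
  from below by \<open>(card H)\<^sup>2 / n\<^sup>2\<close>.\<close>

lemma few_bad_triples:
  fixes \<tau> q l D :: nat and C :: real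
  assumes budget: "\<And>S. q * card (link_graph V H S - F S) \<le> q * D * n + 2 * l * card (link_graph V H S)"
    and q: "q = 36 * \<tau> * l" "0 < l" "0 < \<tau>" and D: "D ^ 3 \<le> n" and n: "0 < n"
    and C: "0 \<le> C" "2 * (81 * (real \<tau>)\<^sup>2 + 18 * real \<tau> + 1 + 3 * real \<tau> * m) \<le> C\<^sup>2"
    and dense: "C * n powr (8 / 3) < card H"
  shows "\<exists>w\<in>V \<times> V. card (bad w) * \<tau> < card (apexes w) ^ 3"
proof (rule ccontr)
  assume "\<not> ?thesis"
  then have large: "card (apexes w) ^ 3 \<le> card (bad w) * \<tau>" if "w \<in> V \<times> V" for w
    using that by (meson not_le)
  \<comment> \<open>Working with the cube root of \<open>n\<close> makes all exponents integral: the
    target \<open>n powr (10 / 3)\<close> is \<open>u ^ 10\<close>.\<close>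
  define u where "u = real n powr (1 / 3)"
  have u: "1 \<le> u" unfolding u_def using n by (intro ge_one_powr_ge_zero) auto
  have u3: "u ^ 3 = n" unfolding u_def using n by (simp add: powr_power)
  have u8: "real n powr (8 / 3) = u ^ 8" unfolding u_def using n by (simp add: powr_power)
  define Q where "Q = (\<Sum>w\<in>V \<times> V. (real (card (apexes w)))\<^sup>2)"
  define P where "P = (\<Sum>w\<in>V \<times> V. real (card (unlinked w)))"
  define T where "T = (\<Sum>w\<in>V \<times> V. real (card (poor w)))"
  have cV: "real (card (V \<times> V)) = u ^ 6"
    unfolding card_cartesian_product of_nat_mult u3[symmetric] by (simp flip: power_add)
  have "(real (card (apexes w)))\<^sup>2
      \<le> 81 * (real \<tau>)\<^sup>2 + 9 * real \<tau> * real (card (unlinked w)) + u ^ 4 + 3 * real \<tau> * real (card (poor w)) / u\<^sup>2"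
    if "w \<in> V \<times> V" for w
  proof (rule square_le_of_cube_le)
    have "card (apexes w) ^ 3 \<le> (3 * (card (apexes w))\<^sup>2 + 3 * card (unlinked w) * card (apexes w)
        + card (poor w)) * \<tau>"
      using large[OF that] card_bad[of w] by (meson le_trans mult_le_mono1)
    then have "real (card (apexes w) ^ 3) \<le> real ((3 * (card (apexes w))\<^sup>2
        + 3 * card (unlinked w) * card (apexes w) + card (poor w)) * \<tau>)"
      by (rule of_nat_mono)
    then show "(real (card (apexes w))) ^ 3 \<le> real \<tau> * (3 * (real (card (apexes w)))\<^sup>2
        + 3 * real (card (unlinked w)) * real (card (apexes w)) + real (card (poor w)))"
      by (simp add: algebra_simps)
  qed (use u in auto)
  then have "Q \<le> (\<Sum>w\<in>V \<times> V. 81 * (real \<tau>)\<^sup>2 + 9 * real \<tau> * real (card (unlinked w)) + u ^ 4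
      + 3 * real \<tau> * real (card (poor w)) / u\<^sup>2)"
    unfolding Q_def by (rule sum_mono)
  also have "\<dots> = u ^ 6 * (81 * (real \<tau>)\<^sup>2 + u ^ 4) + 9 * real \<tau> * P + 3 * real \<tau> * T / u\<^sup>2"
    unfolding P_def T_def
    by (simp add: sum.distrib sum_distrib_left sum_divide_distrib cV algebra_simps del: card_cartesian_product)
  finally have Q: "Q \<le> u ^ 6 * (81 * (real \<tau>)\<^sup>2 + u ^ 4) + 9 * real \<tau> * P + 3 * real \<tau> * T / u\<^sup>2" .
  have "T \<le> real (n ^ 4 * m)"
    unfolding T_def using of_nat_mono[OF sum_poor, where 'a = real] by simp
  also have "\<dots> = u ^ 12 * m" unfolding of_nat_mult of_nat_power u3[symmetric] by (simp flip: power_mult)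
  finally have "3 * real \<tau> * T / u\<^sup>2 \<le> 3 * real \<tau> * (u ^ 12 * m) / u\<^sup>2"
    by (intro divide_right_mono mult_left_mono) auto
  also have "\<dots> = 3 * real \<tau> * m * u ^ 10" using u by (simp add: field_simps flip: power_add)
  finally have T: "3 * real \<tau> * T / u\<^sup>2 \<le> 3 * real \<tau> * m * u ^ 10" .
  \<comment> \<open>So the loss \<open>D * n\<close> per common link sums to at most
    \<open>u ^ 10\<close> over all ordered pairs.\<close>
  have Du: "real D \<le> u"
  proof -
    have "real D ^ 3 \<le> u ^ 3" unfolding u3 using of_nat_mono[OF D, where 'a = real] by simp
    then show ?thesis using u by (simp add: power_mono_iff)
  qed
  have "real q * P \<le> (\<Sum>p\<in>V \<times> V. 2 * real q * D * n
      + 2 * l * (2 * real (card (link_graph V H {fst p, snd p}))))"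
  proof -
    have "real q * P = (\<Sum>p\<in>V \<times> V. 2 * (real q * card (link_graph V H {fst p, snd p} - F {fst p, snd p})))"
      unfolding P_def of_nat_sum[symmetric] sum_unlinked by (simp add: sum_distrib_left algebra_simps)
    also have "\<dots> \<le> (\<Sum>p\<in>V \<times> V. 2 * (real q * D * n + 2 * l * real (card (link_graph V H {fst p, snd p}))))"
    proof (intro sum_mono mult_left_mono)
      fix p
      show "real q * card (link_graph V H {fst p, snd p} - F {fst p, snd p})
          \<le> real q * D * n + 2 * l * real (card (link_graph V H {fst p, snd p}))"
        using of_nat_mono[OF budget[of "{fst p, snd p}"], where 'a = real] by simp
    qed simp
    finally show ?thesis by (simp add: algebra_simps)
  qed
  also have "\<dots> = u ^ 6 * (2 * real q * D * n) + 2 * l * Q"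
  proof -
    have "Q = (\<Sum>p\<in>V \<times> V. 2 * real (card (link_graph V H {fst p, snd p})))"
      unfolding Q_def using arg_cong[OF sum_apexes_squared, of real] by simp
    then show ?thesis
      by (simp add: sum.distrib sum_distrib_left cV del: card_cartesian_product)
  qed
  also have "\<dots> \<le> u ^ 6 * (2 * real q * u * u ^ 3) + 2 * l * Q"
    unfolding u3[symmetric] using Du u by (intro add_mono mult_left_mono mult_right_mono) auto
  also have "\<dots> = l * (72 * real \<tau> * u ^ 10 + 2 * Q)"
    by (simp add: q algebra_simps flip: power_add power_Suc)
  finally have "l * (36 * real \<tau> * P) \<le> l * (72 * real \<tau> * u ^ 10 + 2 * Q)" by (simp add: q algebra_simps)
  then have "36 * real \<tau> * P \<le> 72 * real \<tau> * u ^ 10 + 2 * Q" using q(2) by simp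
  \<comment> \<open>The factor 36 in \<open>q\<close> was chosen for this:
    \<open>9 * \<tau> * P\<close> is at most \<open>18 * \<tau> * u ^ 10 + Q / 2\<close>, and
    \<open>Q / 2\<close> is moved to the left.\<close>
  then have "Q \<le> 2 * (u ^ 6 * (81 * (real \<tau>)\<^sup>2 + u ^ 4) + 18 * real \<tau> * u ^ 10 + 3 * real \<tau> * m * u ^ 10)"
    using Q T by (simp add: algebra_simps)
  also have "\<dots> \<le> 2 * (u ^ 6 * (81 * (real \<tau>)\<^sup>2 * u ^ 4 + u ^ 4) + 18 * real \<tau> * u ^ 10 + 3 * real \<tau> * m * u ^ 10)"
  proof -
    have "81 * (real \<tau>)\<^sup>2 * 1 \<le> 81 * (real \<tau>)\<^sup>2 * u ^ 4"
      using u one_le_power[OF u, of 4] by (intro mult_left_mono) auto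
    then have "u ^ 6 * (81 * (real \<tau>)\<^sup>2 + u ^ 4) \<le> u ^ 6 * (81 * (real \<tau>)\<^sup>2 * u ^ 4 + u ^ 4)"
      using u by (intro mult_left_mono) auto
    then show ?thesis by simp
  qed
  also have "\<dots> = (2 * (81 * (real \<tau>)\<^sup>2 + 18 * real \<tau> + 1 + 3 * real \<tau> * m)) * u ^ 10"
    by (simp add: algebra_simps flip: power_add)
  also have "\<dots> \<le> C\<^sup>2 * u ^ 10"
    using C(2) u by (intro mult_right_mono) auto
  finally have Q_le: "Q \<le> C\<^sup>2 * u ^ 10" .
  have "real (card H) \<le> (\<Sum>w\<in>V \<times> V. real (card (apexes w)))"
    using of_nat_mono[OF card_le_sum_apexes, where 'a = real] by simp
  then have "(real (card H))\<^sup>2 \<le> (\<Sum>w\<in>V \<times> V. real (card (apexes w)))\<^sup>2"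
    by (intro power_mono) auto
  also have "\<dots> \<le> Q * u ^ 6"
    unfolding Q_def cV[symmetric] by (rule sum_squared_le_sum_of_squares)
  also have "\<dots> \<le> C\<^sup>2 * u ^ 10 * u ^ 6" using Q_le u by (intro mult_right_mono) auto
  also have "\<dots> = (C * u ^ 8)\<^sup>2" by (simp add: power_mult_distrib flip: power_add power_mult)
  finally have "real (card H) \<le> C * u ^ 8"
    by (rule power2_le_imp_le) (use C(1) u in auto)
  then show False using dense u8 by simp
qed

end

text \<open>\<open>D\<close> will be cubic in \<open>k\<close>, roughly the logarithm of
  \<open>n\<close>, so \<open>D ^ 3 \<le> n\<close> amounts to comparing a ninth power with
  \<open>2 ^ k\<close>.\<close>

lemma power9_le_power2:
  fixes c :: nat
  shows "\<exists>k0. \<forall>k\<ge>k0. c * (k + 1) ^ 9 \<le> 2 ^ k"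
proof -
  have "(\<lambda>k. (real k + 1) ^ 9 / 2 ^ k) \<longlonglongrightarrow> 0" by real_asymp
  then have "\<forall>\<^sub>F k in sequentially. (real k + 1) ^ 9 / 2 ^ k < 1 / (real c + 1)"
    by (rule order_tendstoD) simp
  then obtain k0 where k0: "\<And>k. k \<ge> k0 \<Longrightarrow> (real k + 1) ^ 9 / 2 ^ k < 1 / (real c + 1)"
    by (auto simp: eventually_sequentially)
  have "c * (k + 1) ^ 9 \<le> 2 ^ k" if "k \<ge> k0" for k
  proof -
    have "(real c + 1) * (real k + 1) ^ 9 < 2 ^ k"
      using k0[OF that] by (simp add: field_simps)
    moreover have "0 \<le> (real k + 1) ^ 9" by simp
    ultimately have "real c * (real k + 1) ^ 9 \<le> 2 ^ k" unfolding distrib_right by linarith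
    then have "real (c * (k + 1) ^ 9) \<le> real (2 ^ k)" by (simp add: add.commute)
    then show ?thesis by (simp only: of_nat_le_iff)
  qed
  then show ?thesis by blast
qed

section \<open>The upper bound\<close>

text \<open>The vertices \<open>v\<close> are apexes of \<open>w\<close> without bad triples, and
  \<open>y\<close> is the second component of \<open>w\<close>. Feet are then chosen greedily: each
  has at least \<open>m\<close> candidates, while at most \<open>t + t ^ 3\<close> vertices are
  forbidden.\<close>

lemma (in link_subgraphs) contains_homeomorph_of_few_bad_triples:
  assumes t: "3 \<le> t" and m: "t ^ 3 + t < m" and w: "card (bad w) * t ^ 3 < card (apexes w) ^ 3"
    and rob: "\<And>S. robust D s L (F S)"
    and D: "t + t ^ 3 + 1 + t\<^sup>2 * (t + 1) + t + 1 \<le> D"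
    and s: "t + t ^ 3 + 1 + t\<^sup>2 * (t + 1) + t ^ 3 * L \<le> s"
  shows "contains_homeomorph H (complete3 t)"
proof -
  define y where "y = snd w"
  obtain v where v: "v \<in> {..<t} \<rightarrow> apexes w" "\<And>i j k. flag t i j k \<Longrightarrow> (v i, v j, v k) \<notin> bad w"
    using avoid_bad_triples[OF finite_apexes _ t w] by (auto simp: bad_def)
  have good: "v i \<noteq> v j" "m \<le> card {x \<in> V. {x, y} \<in> common (v i, v j, v k)}" if "flag t i j k" for i j k
  proof -
    have "v i \<in> apexes w" "v j \<in> apexes w" "v k \<in> apexes w"
      using v(1) that by (auto simp: flag_def)
    then show "v i \<noteq> v j" "m \<le> card {x \<in> V. {x, y} \<in> common (v i, v j, v k)}"
      using v(2)[OF that] by (auto simp: bad_def y_def)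
  qed
  have inj_v: "inj_on v {..<t}"
  proof (rule inj_onI, rule ccontr)
    fix i j assume ij: "i \<in> {..<t}" "j \<in> {..<t}" "v i = v j" "i \<noteq> j"
    \<comment> \<open>Badness is a condition on triples, so a third index is needed to separate
      \<open>v i\<close> from \<open>v j\<close>.\<close>
    have "card {i, j} < card {..<t}" using t ij by simp
    then have "\<not> {..<t} \<subseteq> {i, j}" using card_mono[of "{i, j}" "{..<t}"] by auto
    then obtain k where "k < t" "k \<noteq> i" "k \<noteq> j" by auto
    then show False using good(1)[of i j k] ij by (auto simp: flag_def)
  qed
  define foot where "foot \<tau> z \<longleftrightarrow> (\<forall>i\<in>\<tau>. \<forall>j\<in>\<tau>. i \<noteq> j \<longrightarrow> {z, y} \<in> F {v i, v j})" for \<tau> z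
  have "\<exists>x. \<forall>\<tau>\<in>triples t. foot \<tau> (x \<tau>) \<and> finite {x \<tau>} \<and> card {x \<tau>} \<le> 1 \<and> {x \<tau>} \<inter> v ` {..<t} = {}
      \<and> (\<forall>\<tau>'\<in>triples t. \<tau>' \<noteq> \<tau> \<longrightarrow> {x \<tau>} \<inter> {x \<tau>'} = {})"
  proof (rule greedy_disjoint[OF card_triples(1)])
    show "card (v ` {..<t}) + card (triples t) * 1 \<le> t + t ^ 3"
      using card_image_le[of "{..<t}" v] card_triples[of t] by simp
    fix \<tau> and A :: "nat set" assume \<tau>: "\<tau> \<in> triples t" and A: "finite A" "card A \<le> t + t ^ 3"
    obtain i j k where ijk: "\<tau> = {i, j, k}" "flag t i j k" using \<tau> by (auto simp: triples_def)
    have "card A < card {x \<in> V. {x, y} \<in> common (v i, v j, v k)}"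
      using good(2)[OF ijk(2)] m A by linarith
    then obtain z where z: "{z, y} \<in> common (v i, v j, v k)" "z \<notin> A"
      using A(1) by (metis (no_types, lifting) card_mono leD mem_Collect_eq subsetI)
    have "foot \<tau> z"
      using z(1) ijk(1) by (auto simp: foot_def common_def insert_commute)
    then show "\<exists>z. foot \<tau> z \<and> finite {z} \<and> card {z} \<le> 1 \<and> {z} \<inter> A = {}" using z(2) by auto
  qed simp
  then obtain x where x: "\<forall>\<tau>\<in>triples t. foot \<tau> (x \<tau>) \<and> finite {x \<tau>} \<and> card {x \<tau>} \<le> 1
      \<and> {x \<tau>} \<inter> v ` {..<t} = {} \<and> (\<forall>\<tau>'\<in>triples t. \<tau>' \<noteq> \<tau> \<longrightarrow> {x \<tau>} \<inter> {x \<tau>'} = {})" ..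
  interpret anchored t D s L H "\<lambda>e. F (v ` e)" v x y
  proof
    show "inj_on x (triples t)" using x by (intro inj_onI) auto
    show "x \<tau> \<noteq> v i" if "\<tau> \<in> triples t" "i < t" for \<tau> i using x that by auto
    show "card p = 2 \<and> insert (v i) p \<in> H" if "p \<in> F (v ` {i, j})" for p i j
      using that F_sub[of "v ` {i, j}"] by (auto simp: link_graph_def)
    show "finite (F (v ` e))" for e
      using F_sub graph_on_finite[OF graph_on_link[OF finV]] finite_subset by blast
    show "{x {i, j, k}, y} \<in> F (v ` {i, j})" if "flag t i j k" for i j k
    proof -
      have "{i, j, k} \<in> triples t" using that by (auto simp: triples_def)
      then have "foot {i, j, k} (x {i, j, k})" using x by blast
      then show ?thesis using that by (auto simp: foot_def flag_def)
    qed
  qed (use t inj_v rob D s in auto)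
  show ?thesis by (rule contains_homeomorph_complete3)
qed

lemma card_link_graph_le:
  assumes "finite V"
  shows "card (link_graph V H S) \<le> (card V)\<^sup>2"
proof -
  have "2 * card (link_graph V H S) \<le> card (V \<times> V)"
    unfolding card_ordered_edges[OF graph_on_link[OF assms], symmetric]
    using assms by (intro card_mono) auto
  then show ?thesis by (simp add: card_cartesian_product power2_eq_square)
qed

lemma contains_homeomorph_small:
  assumes "t < 3"
  shows "contains_homeomorph H (complete3 t)"
proof -
  have "e \<notin> complete3 t" for e
    using card_mono[of "{0..<t}" e] assms by (auto simp: complete3_def)
  then have "complete3 t = {}" by blast
  then have "realization_space {} homeomorphic_space realization_space (complete3 t)"
    by (simp add: homeomorphic_space_refl)
  then show ?thesis unfolding contains_homeomorph_def by blast
qed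

text \<open>Every link graph has fewer than \<open>2 ^ l\<close> edges. For fixed \<open>t\<close>
  the orders of \<open>q\<close>, \<open>L\<close>, \<open>s\<close>, \<open>D\<close> are
  \<open>k\<close>, \<open>k ^ 2\<close>, \<open>k ^ 2\<close>, \<open>k ^ 3\<close>. The
  decomposition loses the fraction \<open>2 * l / q = 1 / (18 * \<tau>)\<close> of the edges and at
  most \<open>D * card V\<close> more.\<close>

lemma contains_homeomorph_of_dense:
  fixes t k :: nat
  defines "\<tau> \<equiv> t ^ 3" and "l \<equiv> 2 * (k + 1)" and "b \<equiv> t + t ^ 3 + 1 + t\<^sup>2 * (t + 1)"
    and "m \<equiv> t ^ 3 + t + 1"
  defines "q \<equiv> 36 * \<tau> * l"
  defines "L \<equiv> 4 * q * l"
  defines "s \<equiv> b + \<tau> * L"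
  defines "D \<equiv> 2 * q * s + b + t + 1"
  assumes t: "3 \<le> t" and H: "uniform3_on V H"
    and k: "2 ^ k \<le> card V" "card V < 2 ^ (k + 1)" and D: "D ^ 3 \<le> 2 ^ k"
    and C: "0 \<le> C" "2 * (81 * (real \<tau>)\<^sup>2 + 18 * real \<tau> + 1 + 3 * real \<tau> * m) \<le> C\<^sup>2"
    and dense: "C * real (card V) powr (8 / 3) < card H"
  shows "contains_homeomorph H (complete3 t)"
proof -
  have finV: "finite V" using H by (simp add: uniform3_on_def)
  have pos: "0 < \<tau>" "0 < l" "0 < q" "0 < D" using t by (auto simp: \<tau>_def l_def q_def D_def)
  have "\<exists>F\<subseteq>link_graph V H S. robust D s L F \<and>
      q * card (link_graph V H S - F) \<le> q * D * card V + 2 * l * card (link_graph V H S)" for S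
    unfolding L_def
  proof (rule robust_decomposition[OF graph_on_link[OF finV] pos(3) _ pos(4) _ order_refl])
    show "2 * q * s \<le> D" by (simp add: D_def)
    have "(card V)\<^sup>2 < (2 ^ (k + 1))\<^sup>2" using k(2) by (intro power_strict_mono) auto
    then have "(card V)\<^sup>2 < 2 ^ l" by (simp add: l_def power_mult[symmetric] mult.commute)
    then show "card (link_graph V H S) < 2 ^ l"
      using card_link_graph_le[OF finV, of H S] by linarith
  qed
  then obtain F where F: "\<And>S. F S \<subseteq> link_graph V H S" "\<And>S. robust D s L (F S)"
    "\<And>S. q * card (link_graph V H S - F S) \<le> q * D * card V + 2 * l * card (link_graph V H S)"
    by metis
  interpret link_subgraphs V H F m
    using H F(1) by unfold_locales
  have "0 < card V" using k(1) by (metis less_le_trans zero_less_numeral zero_less_power)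
  then obtain w where "card (bad w) * \<tau> < card (apexes w) ^ 3"
    using few_bad_triples[OF F(3) q_def[THEN meta_eq_to_obj_eq] pos(2,1) _ _ C dense] D k(1) by auto
  then show ?thesis
    using t F(2) by (intro contains_homeomorph_of_few_bad_triples[where w = w and D = D and s = s and L = L])
      (auto simp: \<tau>_def m_def D_def s_def b_def)
qed

theorem theorem1p1:
  fixes t :: nat
  shows "\<exists>C::real. \<forall>(V::nat set) (H::nat set set).
           uniform3_on V H \<and> real (card H) > C * real (card V) powr (8/3)
           \<longrightarrow> contains_homeomorph H (complete3 t)"
proof (cases "3 \<le> t")
  case False
  then show ?thesis using contains_homeomorph_small by simp
next
  case True
  define \<tau> where "\<tau> = t ^ 3"
  define b where "b = t + t ^ 3 + 1 + t\<^sup>2 * (t + 1)"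
  \<comment> \<open>The sum of the coefficients of \<open>D k\<close> as a polynomial in
    \<open>k + 1\<close>, which has degree 3.\<close>
  define c where "c = 144 * \<tau> * b + 144 * 576 * \<tau> ^ 3 + b + t + 1"
  define D where "D k = 2 * (36 * \<tau> * (2 * (k + 1))) * (b + \<tau> * (4 * (36 * \<tau> * (2 * (k + 1)))
      * (2 * (k + 1)))) + b + t + 1" for k
  have "D k \<le> c * (k + 1) ^ 3" for k
  proof -
    have "D k = 144 * \<tau> * b * (k + 1) + 144 * 576 * \<tau> ^ 3 * (k + 1) ^ 3 + (b + t + 1)"
      unfolding D_def by (simp add: algebra_simps power3_eq_cube)
    also have "\<dots> \<le> 144 * \<tau> * b * (k + 1) ^ 3 + 144 * 576 * \<tau> ^ 3 * (k + 1) ^ 3 + (b + t + 1) * (k + 1) ^ 3"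
    proof (intro add_mono mult_left_mono)
      show "b + t + 1 \<le> (b + t + 1) * (k + 1) ^ 3"
        using mult_le_mono2[of 1 "(k + 1) ^ 3" "b + t + 1"] by simp
      show "k + 1 \<le> (k + 1) ^ 3" using power_increasing[of 1 3 "k + 1"] by simp
    qed simp_all
    also have "\<dots> = c * (k + 1) ^ 3" by (simp add: c_def algebra_simps)
    finally show ?thesis .
  qed
  then have D3: "D k ^ 3 \<le> c ^ 3 * (k + 1) ^ 9" for k
    using power_mono[of "D k" "c * (k + 1) ^ 3" 3] by (simp add: power_mult_distrib flip: power_mult)
  obtain k0 where k0: "\<And>k. k0 \<le> k \<Longrightarrow> c ^ 3 * (k + 1) ^ 9 \<le> 2 ^ k"
    using power9_le_power2 by blast
  define C1 where "C1 = 2 * (81 * (real \<tau>)\<^sup>2 + 18 * real \<tau> + 1 + 3 * real \<tau> * (t ^ 3 + t + 1))"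
  \<comment> \<open>\<open>C1\<close> meets the condition of the counting argument, since
    \<open>C \<le> C\<^sup>2\<close>; the power of two forces \<open>k0 \<le> k\<close>.\<close>
  define C where "C = max (2 ^ k0) C1"
  have C1: "1 \<le> C1" by (simp add: C1_def)
  then have C: "1 \<le> C" "C1 \<le> C\<^sup>2" "2 ^ k0 \<le> C"
  proof -
    show "1 \<le> C" "2 ^ k0 \<le> C" using C1 by (auto simp: C_def)
    then have "C * 1 \<le> C * C" by (intro mult_left_mono) auto
    then show "C1 \<le> C\<^sup>2" by (simp add: C_def power2_eq_square)
  qed
  have "contains_homeomorph H (complete3 t)"
    if H: "uniform3_on V H" and dense: "C * real (card V) powr (8 / 3) < card H" for V H
  proof -
    have finV: "finite V" using H by (simp add: uniform3_on_def)
    have cH: "real (card H) \<le> real (card V) ^ 3"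
    proof -
      have "H \<subseteq> {e. e \<subseteq> V \<and> card e = 3}" using H by (auto simp: uniform3_on_def)
      then have "card H \<le> card V choose 3"
        using card_mono[of "{e. e \<subseteq> V \<and> card e = 3}" H] finV by (simp add: n_subsets)
      also have "\<dots> \<le> card V ^ 3" using binomial_le_pow[of 3 "card V"] by (cases "3 \<le> card V") (auto simp: binomial_eq_0)
      finally show ?thesis by (metis of_nat_le_iff of_nat_power)
    qed
    have V: "0 < card V" using dense cH by (cases "card V") auto
    \<comment> \<open>There are at most \<open>n ^ 3\<close> edges in total, so the density
      assumption already forces \<open>n\<close> to be large.\<close>
    have big: "C < card V"
    proof (rule ccontr)
      assume "\<not> C < card V"
      have "real (card V) ^ 3 = real (card V) powr (1 / 3) * real (card V) powr (8 / 3)"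
        using V by (simp flip: powr_add powr_numeral)
      also have "\<dots> \<le> real (card V) powr 1 * real (card V) powr (8 / 3)"
        using V by (intro mult_right_mono powr_mono) auto
      also have "\<dots> \<le> C * real (card V) powr (8 / 3)"
        using \<open>\<not> C < card V\<close> by (intro mult_right_mono) auto
      finally show False using dense cH by linarith
    qed
    obtain k where k: "2 ^ k \<le> card V" "card V < 2 ^ (k + 1)"
      using ex_power_ivl1[of 2 "card V"] V by auto
    have "(2::real) ^ k0 < 2 ^ (k + 1)"
      using C(3) big k(2) by (metis less_trans of_nat_less_iff of_nat_numeral of_nat_power order_le_less_trans)
    then have "k0 < k + 1" by (rule power_less_imp_less_exp[rotated]) simp
    then have "k0 \<le> k" by simp
    then have "D k ^ 3 \<le> 2 ^ k" using D3 k0 le_trans by blast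
    then show ?thesis
      using C C1 k dense
      by (intro contains_homeomorph_of_dense[OF True H k]) (auto simp: D_def \<tau>_def b_def C1_def)
  qed
  then show ?thesis by (metis)
qed

end
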